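(* Let $\{S_n\}_{n\ge 0}$ be the one-dimensional elephant random walk with first-step parameter $q\in(0,1]$ and memory parameter $p\in(0,1)$, and let $\alpha:=2p-1$. (i) (Diffusive regime) If $\alpha<\frac12$, then, as $n\to\infty$, $$\frac{S_n-\mathbb{E}[S_n]}{\sqrt n}\overset{d}{\longrightarrow}\mathcal{N}\Big(0,\frac{1}{1-2\alpha}\Big).$$ (ii) (Critical regime) If $\alpha=\frac12$, then, as $n\to\infty$, $$\frac{S_n-\mathbb{E}[S_n]}{\sqrt{n\log n}}\overset{d}{\longrightarrow}\mathcal{N}(0,1).$$
   Context: Elephant random walk (ERW): let $q\in(0,1]$ and $p\in(0,1)$. The first step $X_1$ satisfies $\mathbb{P}\{X_1=1\}=q$, $\mathbb{P}\{X_1=-1\}=1-q$. For $n\ge1$, let $U_n$ be uniformly distributed on $\{1,\dots,n\}$; then $X_{n+1}=X_{U_n}$ with probability $p$ and $X_{n+1}=-X_{U_n}$ with probability $1-p$, where $U_n$ and the choice of sign are independent of each other and of $(X_1,\dots,X_n)$. The walk is $S_0=0$, $S_n=X_1+\dots+X_n$ for $n\ge1$. Notation: $\overset{d}{\longrightarrow}$ denotes convergence in distribution; $\mathcal{N}(0,\sigma^2)$ is the Gaussian distribution with mean $0$ and variance $\sigma^2$. *)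

theory Defs
  imports "HOL-Probability.Probability"
begin

text \<open>The three sources of randomness in one step of the walk. They only serve as indices, since
  they take values in different types and \<open>indep_vars\<close> requires a common one.\<close>

datatype source = Past | Recall | Sign

text \<open>\<open>X n\<close> is the \<open>n\<close>-th step for \<open>n \<ge> 1\<close>; \<open>X 0\<close>, \<open>U 0\<close> and \<open>K 0\<close> are unconstrained and
  play no role. At time \<open>n\<close> the remembered index is \<open>U n\<close>, and \<open>K n\<close> is the event that the
  remembered step is kept rather than reversed. The generated sigma-algebras are written as
  \<open>vimage_algebra\<close>, and independence is the mutual independence of
  \<open>(X 1, \<dots>, X n)\<close>, \<open>U n\<close> and \<open>K n\<close>.\<close>

locale elephant_random_walk = prob_space M
  for M :: "'a measure" +
  fixes q p :: real
    and X :: "nat \<Rightarrow> 'a \<Rightarrow> real"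
    and U :: "nat \<Rightarrow> 'a \<Rightarrow> nat"
    and K :: "nat \<Rightarrow> 'a \<Rightarrow> bool"
  assumes X_measurable: "n \<ge> 1 \<Longrightarrow> X n \<in> borel_measurable M"
    and U_measurable: "n \<ge> 1 \<Longrightarrow> U n \<in> measurable M (count_space UNIV)"
    and K_measurable: "n \<ge> 1 \<Longrightarrow> K n \<in> measurable M (count_space UNIV)"
    and first_step_plus: "prob {\<omega> \<in> space M. X 1 \<omega> = 1} = q"
    and first_step_minus: "prob {\<omega> \<in> space M. X 1 \<omega> = -1} = 1 - q"
    and U_uniform: "n \<ge> 1 \<Longrightarrow> distr M (count_space UNIV) (U n) = measure_pmf (pmf_of_set {1..n})"
    and K_prob: "n \<ge> 1 \<Longrightarrow> prob {\<omega> \<in> space M. K n \<omega>} = p"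
    and indep_step: "n \<ge> 1 \<Longrightarrow> indep_sets (\<lambda>s. case s of
            Past \<Rightarrow> sets (vimage_algebra (space M) (\<lambda>\<omega>. \<lambda>i\<in>{1..n}. X i \<omega>) (Pi\<^sub>M {1..n} (\<lambda>_. borel)))
          | Recall \<Rightarrow> sets (vimage_algebra (space M) (U n) (count_space UNIV))
          | Sign \<Rightarrow> sets (vimage_algebra (space M) (K n) (count_space UNIV))) UNIV"
    and next_step: "n \<ge> 1 \<Longrightarrow> AE \<omega> in M.
          X (n + 1) \<omega> = (if K n \<omega> then X (U n \<omega>) \<omega> else - X (U n \<omega>) \<omega>)"

definition walk :: "(nat \<Rightarrow> 'a \<Rightarrow> real) \<Rightarrow> nat \<Rightarrow> 'a \<Rightarrow> real" where
  "walk X n \<omega> = (\<Sum>i=1..n. X i \<omega>)"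

text \<open>The parameters are the mean and the variance, whereas \<open>normal_density\<close> takes the
  standard deviation.\<close>

definition gaussian :: "real \<Rightarrow> real \<Rightarrow> real measure" where
  "gaussian m v = density lborel (\<lambda>x. ennreal (normal_density m (sqrt v) x))"

definition converges_in_distribution ::
  "'a measure \<Rightarrow> (nat \<Rightarrow> 'a \<Rightarrow> real) \<Rightarrow> real measure \<Rightarrow> bool" where
  "converges_in_distribution M Y N \<longleftrightarrow> weak_conv_m (\<lambda>n. distr M borel (Y n)) N"

end

theory Submission
  imports Defs "HOL-Real_Asymp.Real_Asymp"
begin

text \<open>
  Given the past, the next step of the walk is a random sign with mean \<open>\<alpha> / n * S n\<close>. Hence
  \<open>a n * (S n - E (S n))\<close> is a martingale for the factors \<open>a = norming \<alpha>\<close> with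
  \<open>a (n + 1) * (1 + \<alpha> / n) = a n\<close>, and its increments are \<open>a (n + 1)\<close> times a centred sign whose
  conditional variance is \<open>1 - (\<alpha> * S n / n)\<^sup>2\<close>. As \<open>S n / n\<close> tends to zero in mean square, the
  martingale accumulates by time \<open>n\<close> a variance close to the deterministic quantity
  \<open>V n = \<Sum>k=1..<n. (a (k + 1))\<^sup>2\<close> (\<open>variance_clock\<close>). It diverges exactly if
  \<open>\<alpha> \<le> 1/2\<close>, and then no single increment contributes a positive fraction of it, so a martingale
  central limit theorem is to be expected.

  The central limit theorem is proved directly with characteristic functions. The step from \<open>n\<close> to
  \<open>n + 1\<close> multiplies the characteristic function of the normed walk at frequency \<open>u\<close> by
  \<open>exp (- (u * a (n + 1))\<^sup>2 / 2)\<close>, up to an error consisting of the variance defect and of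
  higher powers of \<open>u * a (n + 1)\<close> (\<open>normed_char_Suc_exp\<close>). The errors are summed, and at
  frequencies of order \<open>1 / sqrt (V n)\<close> the sum is a weighted average, with weights
  \<open>(a (k + 1))\<^sup>2\<close>, of quantities tending to zero; it vanishes by the weighted Cesaro lemma
  (\<open>summed_error_bound\<close>, \<open>relative_error_tendsto_0\<close>). Levy's continuity theorem then gives
  convergence in distribution.

  The rate and the limiting variance come from comparing \<open>V n\<close> with \<open>(a n)\<^sup>2 * D n\<close>, where \<open>D n\<close> is
  \<open>n\<close> or \<open>n * ln n\<close>. The increment of \<open>(a n)\<^sup>2 * D n\<close> is \<open>(a (n + 1))\<^sup>2\<close> times
  \<open>D (n + 1) - D n * (1 + \<alpha> / n)\<^sup>2\<close>. The latter tends to \<open>1 - 2 * \<alpha>\<close> for \<open>D n = n\<close>, and to 1 for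
  \<open>D n = n * ln n\<close> and \<open>\<alpha> = 1/2\<close>. By the same Cesaro lemma the quotient \<open>(a n)\<^sup>2 * D n / V n\<close> has the
  same limit (\<open>scaled_norming_limit\<close>), and the limiting variance is its reciprocal.
\<close>

section \<open>Weighted averages\<close>

text \<open>Only finitely many terms are far from the limit, and their weight is swallowed by the diverging
  total weight. With the squared norming factors as weights, it yields both the growth of the
  accumulated variance and the smallness of the accumulated error.\<close>

lemma weighted_cesaro:
  fixes w x :: "nat \<Rightarrow> real"
  assumes w: "\<And>k. k \<ge> 1 \<Longrightarrow> w k \<ge> 0"
    and div: "filterlim (\<lambda>n. \<Sum>k=1..<n. w k) at_top sequentially"
    and x: "x \<longlonglongrightarrow> L"
  shows "(\<lambda>n. (\<Sum>k=1..<n. w k * x k) / (\<Sum>k=1..<n. w k)) \<longlonglongrightarrow> L"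
proof -
  define W where "W n = (\<Sum>k=1..<n. w k)" for n
  have "(\<lambda>n. (\<Sum>k=1..<n. w k * (x k - L)) / W n) \<longlonglongrightarrow> 0"
  proof (rule LIMSEQ_I)
    fix e :: real assume e: "e > 0"
    then obtain N where N: "\<And>k. k \<ge> N \<Longrightarrow> \<bar>x k - L\<bar> < e / 2"
      using LIMSEQ_D[OF x, of "e / 2"] by auto
    \<comment> \<open>The weights are nonnegative only from index 1 on.\<close>
    define N' where "N' = max N 1"
    define B where "B = (\<Sum>k=1..<N'. w k * \<bar>x k - L\<bar>)"
    have "eventually (\<lambda>n. W n > 2 * \<bar>B\<bar> / e) sequentially"
      using div unfolding W_def filterlim_at_top_dense by blast
    moreover have "eventually (\<lambda>n. n \<ge> N') sequentially"
      by (rule eventually_ge_at_top)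
    ultimately have "eventually (\<lambda>n. norm ((\<Sum>k=1..<n. w k * (x k - L)) / W n - 0) < e) sequentially"
    proof eventually_elim
      case (elim n)
      have W0: "W n > 0"
        using elim(1) e by (intro le_less_trans[OF _ elim(1)]) simp
      have "\<bar>\<Sum>k=1..<n. w k * (x k - L)\<bar> \<le> (\<Sum>k=1..<n. w k * \<bar>x k - L\<bar>)"
        by (rule order_trans[OF sum_abs]) (auto simp: abs_mult w intro!: sum_mono)
      also have "\<dots> = B + (\<Sum>k=N'..<n. w k * \<bar>x k - L\<bar>)"
        unfolding B_def using elim(2) by (subst sum.atLeastLessThan_concat) (auto simp: N'_def)
      also have "(\<Sum>k=N'..<n. w k * \<bar>x k - L\<bar>) \<le> (\<Sum>k=N'..<n. w k * (e/2))"
        using N by (intro sum_mono mult_left_mono w) (auto simp: N'_def less_imp_le)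
      also have "\<dots> = (\<Sum>k=N'..<n. w k) * (e/2)"
        by (simp add: sum_distrib_right)
      also have "(\<Sum>k=N'..<n. w k) \<le> W n"
        unfolding W_def using w by (intro sum_mono2) (auto simp: N'_def)
      finally have "\<bar>\<Sum>k=1..<n. w k * (x k - L)\<bar> \<le> B + W n * (e/2)"
        using e by simp
      also have "\<dots> \<le> \<bar>B\<bar> + W n * (e/2)" by simp
      also have "\<dots> < W n * e"
        using elim(1) e by (simp add: field_simps)
      finally show ?case
        using W0 by (simp add: field_simps)
    qed
    then show "\<exists>no. \<forall>n\<ge>no. norm ((\<Sum>k=1..<n. w k * (x k - L)) / W n - 0) < e"
      by (simp add: eventually_sequentially)
  qed
  then have "(\<lambda>n. (\<Sum>k=1..<n. w k * (x k - L)) / W n + L) \<longlonglongrightarrow> 0 + L"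
    by (intro tendsto_intros)
  moreover have "eventually (\<lambda>n. W n > 0) sequentially"
    using div unfolding W_def filterlim_at_top_dense by blast
  then have "eventually (\<lambda>n. (\<Sum>k=1..<n. w k * (x k - L)) / W n + L
      = (\<Sum>k=1..<n. w k * x k) / W n) sequentially"
  proof eventually_elim
    case (elim n)
    have "(\<Sum>k=1..<n. w k * (x k - L)) = (\<Sum>k=1..<n. w k * x k) - W n * L"
      by (simp add: W_def right_diff_distrib sum_subtractf sum_distrib_right)
    then show ?case using elim by (simp add: field_simps)
  qed
  ultimately show ?thesis
    unfolding W_def by (simp add: tendsto_cong)
qed

lemma harmonic_average_tendsto_0: "(\<lambda>n. (\<Sum>k=1..<n. 1 / real k) / real n) \<longlonglongrightarrow> 0"
proof -
  have "filterlim (\<lambda>n. \<Sum>k=1..<n. (1::real)) at_top sequentially"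
  proof -
    have "filterlim (\<lambda>n. real (n - 1)) at_top sequentially" by real_asymp
    then show ?thesis by simp
  qed
  then have "(\<lambda>n. (\<Sum>k=1..<n. 1 * (1 / real k)) / (\<Sum>k=1..<n. 1)) \<longlonglongrightarrow> 0"
    by (intro weighted_cesaro lim_1_over_n) auto
  moreover have "(\<lambda>n. (real n - 1) / real n) \<longlonglongrightarrow> 1" by real_asymp
  ultimately have "(\<lambda>n. (\<Sum>k=1..<n. 1 * (1 / real k)) / (\<Sum>k=1..<n. 1) * ((real n - 1) / real n)) \<longlonglongrightarrow> 0 * 1"
    by (rule tendsto_mult)
  moreover have "eventually (\<lambda>n. (\<Sum>k=1..<n. 1 * (1 / real k)) / (\<Sum>k=1..<n. 1) * ((real n - 1) / real n)
     = (\<Sum>k=1..<n. 1 / real k) / real n) sequentially"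
    using eventually_gt_at_top[of 1] by eventually_elim (auto simp: of_nat_diff)
  ultimately show ?thesis by (simp add: tendsto_cong)
qed

section \<open>Norming factors and accumulated variance\<close>

text \<open>Since the conditional mean of \<open>S (n + 1)\<close> is \<open>(1 + \<alpha> / n) * S n\<close>, these factors turn the walk
  into a process \<open>norming \<alpha> n * S n\<close> whose conditional mean does not change. In closed form
  \<open>norming \<alpha> n\<close> is \<open>\<Gamma> n * \<Gamma> (1 + \<alpha>) / \<Gamma> (n + \<alpha>)\<close>; the recursion alone suffices below, so no
  asymptotics of the Gamma function are involved.\<close>

definition norming :: "real \<Rightarrow> nat \<Rightarrow> real" where
  "norming \<alpha> n = (\<Prod>k=1..<n. 1 / (1 + \<alpha> / real k))"

text \<open>To leading order, the variance of the normed walk up to time \<open>n\<close>: its \<open>k\<close>-th increment is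
  \<open>norming \<alpha> (k + 1)\<close> times a centred sign. The first step is left out; its contribution stays
  bounded.\<close>

definition variance_clock :: "real \<Rightarrow> nat \<Rightarrow> real" where
  "variance_clock \<alpha> n = (\<Sum>k=1..<n. (norming \<alpha> (Suc k))\<^sup>2)"

lemma norming_1: "norming \<alpha> (Suc 0) = 1"
  by (simp add: norming_def)

lemma one_plus_memory_pos: "-1 < \<alpha> \<Longrightarrow> n \<ge> 1 \<Longrightarrow> 1 + \<alpha> / real n > 0"
  by (simp add: field_simps)

lemma norming_pos: "-1 < \<alpha> \<Longrightarrow> norming \<alpha> n > 0"
  unfolding norming_def by (intro prod_pos) (auto simp: one_plus_memory_pos)

lemma norming_Suc:
  assumes "-1 < \<alpha>" "n \<ge> 1"
  shows "norming \<alpha> n = norming \<alpha> (Suc n) * (1 + \<alpha> / real n)"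
  using one_plus_memory_pos[OF assms] assms by (simp add: norming_def)

lemma variance_clock_Suc: "n \<ge> 1 \<Longrightarrow>
    variance_clock \<alpha> (Suc n) = variance_clock \<alpha> n + (norming \<alpha> (Suc n))\<^sup>2"
  by (simp add: variance_clock_def)

lemma variance_clock_nonneg: "variance_clock \<alpha> n \<ge> 0"
  by (simp add: variance_clock_def sum_nonneg)

lemma variance_clock_mono: "m \<le> n \<Longrightarrow> variance_clock \<alpha> m \<le> variance_clock \<alpha> n"
  unfolding variance_clock_def by (intro sum_mono2) auto

text \<open>In the worst case \<open>\<alpha> = 1/2\<close> the squared norming factors decay like \<open>1 / n\<close>. The shift \<open>1/4\<close> carries
  the induction, because
  \<open>(1 + 1 / (2 * n))\<^sup>2 = 1 + 1 / n + 1 / (4 * n\<^sup>2) \<le> (n + 3/4) / (n - 1/4)\<close>.\<close>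

lemma norming_lower_bound:
  assumes "-1 < \<alpha>" "\<alpha> \<le> 1/2" "n \<ge> 1"
  shows "(norming \<alpha> n)\<^sup>2 * (real n - 1/4) \<ge> 3/4"
  using assms(3)
proof (induction n rule: dec_induct)
  case base
  then show ?case by (simp add: norming_1)
next
  case (step n)
  have pos: "1 + \<alpha> / real n > 0" using assms step by (intro one_plus_memory_pos) auto
  have n: "real n \<ge> 1" using step by simp
  have "(1 + \<alpha> / real n)\<^sup>2 \<le> (1 + 1 / (2 * real n))\<^sup>2"
    using pos assms n by (intro power_mono) (auto simp: field_simps)
  also have "\<dots> * (real n - 1/4) \<le> real (Suc n) - 1/4"
    using n by (simp add: field_simps power2_eq_square)
  finally have *: "(1 + \<alpha> / real n)\<^sup>2 * (real n - 1/4) \<le> real (Suc n) - 1/4"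
    using n by (simp add: mult_right_mono)
  have "3/4 \<le> (norming \<alpha> (Suc n))\<^sup>2 * ((1 + \<alpha> / real n)\<^sup>2 * (real n - 1/4))"
    using step norming_Suc[of \<alpha> n] assms by (simp add: power_mult_distrib mult.assoc)
  also have "\<dots> \<le> (norming \<alpha> (Suc n))\<^sup>2 * (real (Suc n) - 1/4)"
    using * by (intro mult_left_mono) auto
  finally show ?case .
qed

text \<open>Comparison with the harmonic series. This is where the superdiffusive case \<open>\<alpha> > 1/2\<close> has to be
  excluded: there the series converges and the limit is not Gaussian.\<close>

lemma variance_clock_at_top:
  assumes "-1 < \<alpha>" "\<alpha> \<le> 1/2"
  shows "filterlim (variance_clock \<alpha>) at_top sequentially"
proof -
  have lower: "variance_clock \<alpha> (Suc n) \<ge> 3/4 * (harm (Suc n) - 1)" for n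
  proof (induction n)
    case 0
    then show ?case by (simp add: variance_clock_def harm_def)
  next
    case (Suc n)
    have "3/4 \<le> (norming \<alpha> (Suc (Suc n)))\<^sup>2 * (real (Suc (Suc n)) - 1/4)"
      using norming_lower_bound[OF assms, of "Suc (Suc n)"] by simp
    also have "\<dots> \<le> (norming \<alpha> (Suc (Suc n)))\<^sup>2 * real (Suc (Suc n))"
      by (intro mult_left_mono) auto
    finally have "(norming \<alpha> (Suc (Suc n)))\<^sup>2 \<ge> 3/4 * inverse (real (Suc (Suc n)))"
      by (simp add: field_simps)
    then show ?case using Suc variance_clock_Suc[of "Suc n" \<alpha>] by (simp add: harm_Suc[of "Suc n"] algebra_simps)
  qed
  have "filterlim (\<lambda>n. harm n :: real) at_top sequentially"
    by (rule harm_at_top)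
  then have "filterlim (\<lambda>n. harm (Suc n) :: real) at_top sequentially"
    by (subst filterlim_sequentially_Suc)
  then have "filterlim (\<lambda>n. 3/4 * (harm (Suc n) - 1) :: real) at_top sequentially"
    by (intro filterlim_tendsto_pos_mult_at_top[OF tendsto_const])
       (auto simp: filterlim_at_top_add_at_top intro!: filterlim_tendsto_add_at_top[of "\<lambda>_. -1", OF tendsto_const, simplified])
  then have "filterlim (\<lambda>n. variance_clock \<alpha> (Suc n)) at_top sequentially"
    by (rule filterlim_at_top_mono) (use lower in auto)
  then show ?thesis by (subst (asm) filterlim_sequentially_Suc)
qed

text \<open>A Stolz-Cesaro argument: \<open>(norming \<alpha> n)\<^sup>2 * D n\<close> telescopes into a sum with the same weights as
  the variance clock. Both regimes are instances, \<open>D n = n\<close> for \<open>\<alpha> < 1/2\<close> and \<open>D n = n * ln n\<close> for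
  \<open>\<alpha> = 1/2\<close>.\<close>

lemma scaled_norming_limit:
  fixes D :: "nat \<Rightarrow> real"
  assumes "-1 < \<alpha>" "\<alpha> \<le> 1/2"
    and incr: "(\<lambda>n. D (Suc n) - D n * (1 + \<alpha> / real n)\<^sup>2) \<longlonglongrightarrow> L"
  shows "(\<lambda>n. (norming \<alpha> n)\<^sup>2 * D n / variance_clock \<alpha> n) \<longlonglongrightarrow> L"
proof -
  let ?x = "\<lambda>n. D (Suc n) - D n * (1 + \<alpha> / real n)\<^sup>2"
  have eq: "(norming \<alpha> n)\<^sup>2 * D n = D 1 + (\<Sum>k=1..<n. (norming \<alpha> (Suc k))\<^sup>2 * ?x k)" if "n \<ge> 1" for n
    using that
  proof (induction n rule: dec_induct)
    case base
    then show ?case by (simp add: norming_1)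
  next
    case (step n)
    have "(norming \<alpha> (Suc n))\<^sup>2 * D (Suc n)
        = (norming \<alpha> n)\<^sup>2 * D n + (norming \<alpha> (Suc n))\<^sup>2 * ?x n"
      using norming_Suc[OF assms(1) step(1)] by (simp only: power_mult_distrib) (simp add: algebra_simps)
    then show ?case using step by simp
  qed
  have "(\<lambda>n. (\<Sum>k=1..<n. (norming \<alpha> (Suc k))\<^sup>2 * ?x k) / variance_clock \<alpha> n) \<longlonglongrightarrow> L"
    unfolding variance_clock_def
    using variance_clock_at_top[OF assms(1,2)] incr
    by (intro weighted_cesaro) (auto simp: variance_clock_def[abs_def])
  moreover have "(\<lambda>n. D 1 / variance_clock \<alpha> n) \<longlonglongrightarrow> 0"
    by (intro real_tendsto_divide_at_top[OF tendsto_const] variance_clock_at_top assms)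
  ultimately have "(\<lambda>n. D 1 / variance_clock \<alpha> n
      + (\<Sum>k=1..<n. (norming \<alpha> (Suc k))\<^sup>2 * ?x k) / variance_clock \<alpha> n) \<longlonglongrightarrow> 0 + L"
    by (intro tendsto_add)
  moreover have "eventually (\<lambda>n. D 1 / variance_clock \<alpha> n
      + (\<Sum>k=1..<n. (norming \<alpha> (Suc k))\<^sup>2 * ?x k) / variance_clock \<alpha> n
      = (norming \<alpha> n)\<^sup>2 * D n / variance_clock \<alpha> n) sequentially"
    using eventually_ge_at_top[of 1] by eventually_elim (simp add: eq add_divide_distrib)
  ultimately show ?thesis by (simp add: tendsto_cong)
qed

lemma norming_increment_linear: "(\<lambda>n. real (Suc n) - real n * (1 + \<alpha> / real n)\<^sup>2) \<longlonglongrightarrow> 1 - 2 * \<alpha>"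
  by real_asymp

lemma norming_increment_critical:
  "(\<lambda>n. real (Suc n) * ln (real (Suc n)) - real n * ln (real n) * (1 + 1/2 / real n)\<^sup>2) \<longlonglongrightarrow> 1"
  by real_asymp

text \<open>No single increment matters for the total variance (a Lindeberg condition, as the signs are
  bounded). For \<open>\<alpha> = 1/2\<close> the limit \<open>1 - 2 * \<alpha>\<close> below is zero, which only makes the decay
  faster than \<open>1 / n\<close>.\<close>

lemma norming_negligible:
  assumes "-1 < \<alpha>" "\<alpha> \<le> 1/2"
  shows "(\<lambda>n. norming \<alpha> (Suc n) / sqrt (variance_clock \<alpha> (Suc n))) \<longlonglongrightarrow> 0"
proof -
  have "(\<lambda>n. (norming \<alpha> n)\<^sup>2 * real n / variance_clock \<alpha> n * (1 / real n)) \<longlonglongrightarrow> (1 - 2 * \<alpha>) * 0"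
    by (intro tendsto_mult scaled_norming_limit assms norming_increment_linear lim_1_over_n)
  moreover have "eventually (\<lambda>n. (norming \<alpha> n)\<^sup>2 * real n / variance_clock \<alpha> n * (1 / real n)
      = (norming \<alpha> n / sqrt (variance_clock \<alpha> n))\<^sup>2) sequentially"
    using eventually_gt_at_top[of 0]
    by eventually_elim (auto simp: power_divide variance_clock_def sum_nonneg)
  ultimately have "(\<lambda>n. (norming \<alpha> n / sqrt (variance_clock \<alpha> n))\<^sup>2) \<longlonglongrightarrow> 0"
    by (simp add: tendsto_cong)
  then have "(\<lambda>n. sqrt ((norming \<alpha> n / sqrt (variance_clock \<alpha> n))\<^sup>2)) \<longlonglongrightarrow> sqrt 0"
    by (rule tendsto_real_sqrt)
  then have "(\<lambda>n. norming \<alpha> n / sqrt (variance_clock \<alpha> n)) \<longlonglongrightarrow> 0"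
    by (simp add: tendsto_rabs_zero_iff del: abs_divide)
  then show ?thesis by (rule LIMSEQ_Suc)
qed

section \<open>Conditional law of the next step and second moment of the walk\<close>

context elephant_random_walk
begin

text \<open>The three independent sigma-algebras at time \<open>n\<close>, as measures, so that measurability of a
  function with respect to each of them can be stated.\<close>

definition information :: "nat \<Rightarrow> source \<Rightarrow> 'a measure" where
  "information n s = (case s of
      Past \<Rightarrow> vimage_algebra (space M) (\<lambda>\<omega>. \<lambda>i\<in>{1..n}. X i \<omega>) (Pi\<^sub>M {1..n} (\<lambda>_. borel))
    | Recall \<Rightarrow> vimage_algebra (space M) (U n) (count_space UNIV)
    | Sign \<Rightarrow> vimage_algebra (space M) (K n) (count_space UNIV))"

lemma space_information [simp]: "space (information n s) = space M"
  by (cases s) (simp_all add: information_def)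

lemma indep_information: "n \<ge> 1 \<Longrightarrow> indep_sets (\<lambda>s. sets (information n s)) UNIV"
  using indep_step[of n]
  by (rule back_subst[of "\<lambda>F. indep_sets F UNIV"]) (auto simp: information_def fun_eq_iff split: source.split)

lemma subalgebra_information: "n \<ge> 1 \<Longrightarrow> sets (information n s) \<subseteq> events"
  using indep_information[of n] by (auto simp: indep_sets_def)

lemma measurable_information:
  "n \<ge> 1 \<Longrightarrow> f \<in> borel_measurable (information n s) \<Longrightarrow> f \<in> borel_measurable M"
  using subalgebra_information[of n s] by (auto simp: measurable_def)

lemma step_measurable_past:
  assumes "i \<in> {1..n}"
  shows "X i \<in> borel_measurable (information n Past)"
proof -
  have "(\<lambda>\<omega>. \<lambda>i\<in>{1..n}. X i \<omega>) \<in> measurable (information n Past) (Pi\<^sub>M {1..n} (\<lambda>_. borel))"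
    unfolding information_def source.case
    by (rule measurable_vimage_algebra1) (auto simp: space_PiM)
  then have "(\<lambda>\<omega>. (\<lambda>i\<in>{1..n}. X i \<omega>) i) \<in> measurable (information n Past) borel"
    by (rule measurable_compose) (use assms in \<open>rule measurable_component_singleton\<close>)
  then show ?thesis using assms by simp
qed

lemma walk_measurable_past: "walk X n \<in> borel_measurable (information n Past)"
  unfolding walk_def[abs_def] by (intro borel_measurable_sum step_measurable_past)

lemma walk_measurable [measurable]: "walk X n \<in> borel_measurable M"
  unfolding walk_def[abs_def] by (intro borel_measurable_sum X_measurable) auto

lemma recall_measurable: "(\<lambda>\<omega>. f (U n \<omega>)) \<in> borel_measurable (information n Recall)"
  unfolding information_def source.case
  by (rule measurable_compose[OF measurable_vimage_algebra1]) auto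

lemma sign_measurable: "(\<lambda>\<omega>. f (K n \<omega>)) \<in> borel_measurable (information n Sign)"
  unfolding information_def source.case
  by (rule measurable_compose[OF measurable_vimage_algebra1]) auto

text \<open>The three independent sources enter only through this factorisation, with complex factors so
  that it applies to characteristic functions.\<close>

lemma expectation_past_recall_sign:
  fixes F G H :: "'a \<Rightarrow> complex"
  assumes "n \<ge> 1"
    and "F \<in> borel_measurable (information n Past)" "integrable M F"
    and "G \<in> borel_measurable (information n Recall)" "integrable M G"
    and "H \<in> borel_measurable (information n Sign)" "integrable M H"
  shows "integrable M (\<lambda>\<omega>. F \<omega> * G \<omega> * H \<omega>)"
    and "(\<integral>\<omega>. F \<omega> * G \<omega> * H \<omega> \<partial>M) = (\<integral>\<omega>. F \<omega> \<partial>M) * (\<integral>\<omega>. G \<omega> \<partial>M) * (\<integral>\<omega>. H \<omega> \<partial>M)"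
proof -
  define Y where "Y s = (case s of Past \<Rightarrow> F | Recall \<Rightarrow> G | Sign \<Rightarrow> H)" for s
  have UNIV_source: "UNIV = {Past, Recall, Sign}"
    using source.exhaust by auto
  have Y: "Y s \<in> borel_measurable (information n s)" for s
    using assms by (cases s) (auto simp: Y_def)
  have "indep_vars (\<lambda>_. borel) Y UNIV"
    unfolding indep_vars_def2
  proof (intro conjI ballI)
    show "random_variable borel (Y s)" for s
      using Y measurable_information assms(1) by blast
    show "indep_sets (\<lambda>s. {Y s -` A \<inter> space M |A. A \<in> sets borel}) UNIV"
    proof (rule indep_sets_mono_sets[OF indep_information[OF assms(1)]])
      show "{Y s -` A \<inter> space M |A. A \<in> sets borel} \<subseteq> sets (information n s)" for s
        using measurable_sets[OF Y[of s]] by auto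
    qed
  qed
  moreover have "integrable M (Y s)" for s
    using assms by (cases s) (auto simp: Y_def)
  moreover have "finite (UNIV :: source set)"
    unfolding UNIV_source by simp
  ultimately have "integrable M (\<lambda>\<omega>. \<Prod>s\<in>UNIV. Y s \<omega>)"
    "(\<integral>\<omega>. (\<Prod>s\<in>UNIV. Y s \<omega>) \<partial>M) = (\<Prod>s\<in>UNIV. \<integral>\<omega>. Y s \<omega> \<partial>M)"
    using indep_vars_integrable[of UNIV Y] indep_vars_lebesgue_integral[of UNIV Y] by auto
  then show "integrable M (\<lambda>\<omega>. F \<omega> * G \<omega> * H \<omega>)"
    "(\<integral>\<omega>. F \<omega> * G \<omega> * H \<omega> \<partial>M) = (\<integral>\<omega>. F \<omega> \<partial>M) * (\<integral>\<omega>. G \<omega> \<partial>M) * (\<integral>\<omega>. H \<omega> \<partial>M)"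
    by (simp_all add: UNIV_source Y_def mult.assoc)
qed

lemma prob_recall: "n \<ge> 1 \<Longrightarrow> j \<in> {1..n} \<Longrightarrow> prob {\<omega> \<in> space M. U n \<omega> = j} = 1 / real n"
proof -
  assume n: "n \<ge> 1" and j: "j \<in> {1..n}"
  have "prob {\<omega> \<in> space M. U n \<omega> = j} = prob (U n -` {j} \<inter> space M)"
    by (rule arg_cong[of _ _ prob]) auto
  also have "\<dots> = measure (distr M (count_space UNIV) (U n)) {j}"
    using U_measurable[OF n] by (intro measure_distr[symmetric]) auto
  also have "\<dots> = measure_pmf.prob (pmf_of_set {1..n}) {j}"
    by (simp only: U_uniform[OF n])
  also have "\<dots> = 1 / real n"
    using j n by (subst measure_pmf_of_set) auto
  finally show ?thesis .
qed

lemma AE_recall_range: "n \<ge> 1 \<Longrightarrow> AE \<omega> in M. U n \<omega> \<in> {1..n}"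
proof -
  assume n: "n \<ge> 1"
  have "AE j in measure_pmf (pmf_of_set {1..n}). j \<in> {1..n}"
    using n by (subst AE_measure_pmf_iff) (auto simp: set_pmf_of_set)
  then have "AE j in distr M (count_space UNIV) (U n). j \<in> {1..n}"
    by (simp only: U_uniform[OF n])
  then show ?thesis
    by (rule AE_distrD[OF U_measurable[OF n]])
qed

text \<open>Strong induction: each step is, up to sign, one of the earlier steps.\<close>

lemma AE_abs_step: "n \<ge> 1 \<Longrightarrow> AE \<omega> in M. \<bar>X n \<omega>\<bar> = 1"
proof (induction n rule: less_induct)
  case (less n)
  show ?case
  proof (cases "n = 1")
    case True
    have [measurable]: "X 1 \<in> borel_measurable M" by (rule X_measurable) simp
    have E: "{\<omega> \<in> space M. X 1 \<omega> = 1} \<in> events" "{\<omega> \<in> space M. X 1 \<omega> = -1} \<in> events"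
      by measurable
    \<comment> \<open>The two given probabilities add up to 1, so no other value has positive probability.\<close>
    have "prob ({\<omega> \<in> space M. X 1 \<omega> = 1} \<union> {\<omega> \<in> space M. X 1 \<omega> = -1}) = q + (1 - q)"
      using E first_step_plus first_step_minus by (subst finite_measure_Union) auto
    then have "AE \<omega> in M. \<omega> \<in> {\<omega> \<in> space M. X 1 \<omega> = 1} \<union> {\<omega> \<in> space M. X 1 \<omega> = -1}"
      using E by (subst prob_eq_1[symmetric]) auto
    then show ?thesis unfolding True by eventually_elim auto
  next
    case False
    then obtain m where m: "n = m + 1" "m \<ge> 1"
      using less.prems by (cases n) auto
    have "AE \<omega> in M. \<forall>i\<in>{1..m}. \<bar>X i \<omega>\<bar> = 1"
      using less.IH m by (intro AE_finite_allI) auto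
    then show ?thesis
      using AE_recall_range[OF m(2)] next_step[OF m(2)]
      unfolding m(1) by eventually_elim auto
  qed
qed

lemma AE_abs_walk: "AE \<omega> in M. \<bar>walk X n \<omega>\<bar> \<le> real n"
proof -
  have "AE \<omega> in M. \<forall>i\<in>{1..n}. \<bar>X i \<omega>\<bar> = 1"
    using AE_abs_step by (intro AE_finite_allI) auto
  then show ?thesis
  proof eventually_elim
    case (elim \<omega>)
    have "\<bar>walk X n \<omega>\<bar> \<le> (\<Sum>i=1..n. \<bar>X i \<omega>\<bar>)"
      unfolding walk_def by (rule sum_abs)
    also have "\<dots> = real n" using elim by simp
    finally show ?case .
  qed
qed

lemma integrable_bounded_function_of_walk:
  fixes f :: "real \<Rightarrow> 'b :: {banach, second_countable_topology}"
  assumes "f \<in> borel_measurable borel" "\<And>x. \<bar>x\<bar> \<le> real n \<Longrightarrow> norm (f x) \<le> B"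
  shows "integrable M (\<lambda>\<omega>. f (walk X n \<omega>))"
proof (rule integrable_const_bound)
  show "AE \<omega> in M. norm (f (walk X n \<omega>)) \<le> B"
    using AE_abs_walk[of n] by eventually_elim (rule assms(2))
  show "(\<lambda>\<omega>. f (walk X n \<omega>)) \<in> borel_measurable M"
    using assms(1) by measurable
qed

lemma integrable_times_step:
  fixes F :: "'a \<Rightarrow> complex"
  assumes "integrable M F" "i \<ge> 1"
  shows "integrable M (\<lambda>\<omega>. F \<omega> * of_real (X i \<omega>))"
proof -
  have [measurable]: "X i \<in> borel_measurable M" by (rule X_measurable[OF assms(2)])
  show ?thesis
  proof (rule Bochner_Integration.integrable_bound[OF assms(1)])
    show "(\<lambda>\<omega>. F \<omega> * of_real (X i \<omega>)) \<in> borel_measurable M"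
      using assms(1) by measurable
    show "AE \<omega> in M. norm (F \<omega> * of_real (X i \<omega>)) \<le> norm (F \<omega>)"
      using AE_abs_step[OF assms(2)] by eventually_elim (simp add: norm_mult)
  qed
qed

text \<open>The Markov property of the walk in integrated form: the conditional mean of the next step is
  \<open>\<alpha> / n * S n\<close> with \<open>\<alpha> = 2 * p - 1\<close>. A sign \<open>x\<close> satisfies \<open>f x = (f 1 + f (-1)) / 2 + x * (f 1 - f (-1)) / 2\<close>, so this
  first moment determines the conditional law, and conditional expectations can be avoided.
  The proof splits over the remembered index \<open>j\<close>, where the integrand is a function of the past
  (containing \<open>X j\<close>) times a function of the index times a sign.\<close>

lemma next_step_expectation:
  fixes F :: "'a \<Rightarrow> complex"
  assumes n: "n \<ge> 1" and F: "F \<in> borel_measurable (information n Past)" "integrable M F"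
  shows "(\<integral>\<omega>. F \<omega> * of_real (X (Suc n) \<omega>) \<partial>M)
       = (\<integral>\<omega>. F \<omega> * of_real ((2 * p - 1) / real n * walk X n \<omega>) \<partial>M)"
proof -
  define G :: "nat \<Rightarrow> 'a \<Rightarrow> complex" where "G j \<omega> = of_bool (U n \<omega> = j)" for j \<omega>
  define H :: "'a \<Rightarrow> complex" where "H \<omega> = (if K n \<omega> then 1 else -1)" for \<omega>
  have [measurable]: "U n \<in> measurable M (count_space UNIV)" "K n \<in> measurable M (count_space UNIV)"
    using U_measurable K_measurable n by auto
  have GM: "G j \<in> borel_measurable (information n Recall)" for j
    unfolding G_def[abs_def] by (rule recall_measurable)
  have HM: "H \<in> borel_measurable (information n Sign)"
    unfolding H_def[abs_def] by (rule sign_measurable)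
  have G: "integrable M (G j)" for j
    using measurable_information[OF n GM] by (intro integrable_const_bound[of _ 1]) (auto simp: G_def)
  have H: "integrable M H"
    using measurable_information[OF n HM] by (intro integrable_const_bound[of _ 1]) (auto simp: H_def)
  have EG: "(\<integral>\<omega>. G j \<omega> \<partial>M) = 1 / of_nat n" if "j \<in> {1..n}" for j
  proof -
    have "(\<integral>\<omega>. G j \<omega> \<partial>M) = (\<integral>\<omega>. of_real (indicator {\<omega> \<in> space M. U n \<omega> = j} \<omega>) \<partial>M)"
      by (intro Bochner_Integration.integral_cong) (auto simp: G_def indicator_def)
    also have "\<dots> = of_real (prob {\<omega> \<in> space M. U n \<omega> = j})"
      by simp
    finally show ?thesis using prob_recall[OF n that] by simp
  qed
  have EH: "(\<integral>\<omega>. H \<omega> \<partial>M) = of_real (2 * p - 1)"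
  proof -
    have "(\<integral>\<omega>. H \<omega> \<partial>M) = (\<integral>\<omega>. of_real (2 * indicator {\<omega> \<in> space M. K n \<omega>} \<omega> - 1) \<partial>M)"
      by (intro Bochner_Integration.integral_cong) (auto simp: H_def indicator_def)
    also have "\<dots> = of_real (\<integral>\<omega>. 2 * indicator {\<omega> \<in> space M. K n \<omega>} \<omega> - 1 \<partial>M)"
      by (rule integral_complex_of_real)
    also have "(\<integral>\<omega>. 2 * indicator {\<omega> \<in> space M. K n \<omega>} \<omega> - 1 \<partial>M) = 2 * prob {\<omega> \<in> space M. K n \<omega>} - 1"
    proof -
      have "{\<omega> \<in> space M. K n \<omega>} \<in> events" by measurable
      then have "integrable M (indicator {\<omega> \<in> space M. K n \<omega>} :: 'a \<Rightarrow> real)"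
        by (simp add: integrable_indicator_iff less_top[symmetric])
      then show ?thesis by (subst Bochner_Integration.integral_diff) (auto simp: prob_space)
    qed
    finally show ?thesis by (simp add: K_prob[OF n])
  qed
  have FX: "integrable M (\<lambda>\<omega>. F \<omega> * of_real (X j \<omega>))"
    "(\<lambda>\<omega>. F \<omega> * of_real (X j \<omega>)) \<in> borel_measurable (information n Past)" if "j \<in> {1..n}" for j
    using that F integrable_times_step step_measurable_past[OF that] by auto
  note split = expectation_past_recall_sign[OF n FX(2) FX(1) GM G HM H]
  have "(\<integral>\<omega>. F \<omega> * of_real (X (Suc n) \<omega>) \<partial>M)
      = (\<integral>\<omega>. (\<Sum>j=1..n. F \<omega> * of_real (X j \<omega>) * G j \<omega> * H \<omega>) \<partial>M)"
  proof (rule integral_cong_AE)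
    have [measurable]: "X (Suc n) \<in> borel_measurable M" by (rule X_measurable) simp
    show "(\<lambda>\<omega>. F \<omega> * of_real (X (Suc n) \<omega>)) \<in> borel_measurable M"
      using F(2) by measurable
    show "(\<lambda>\<omega>. \<Sum>j=1..n. F \<omega> * of_real (X j \<omega>) * G j \<omega> * H \<omega>) \<in> borel_measurable M"
      using split(1) by (intro borel_measurable_sum) auto
    show "AE \<omega> in M. F \<omega> * of_real (X (Suc n) \<omega>)
        = (\<Sum>j=1..n. F \<omega> * of_real (X j \<omega>) * G j \<omega> * H \<omega>)"
      using next_step[OF n] AE_recall_range[OF n]
    proof eventually_elim
      case (elim \<omega>)
      have "(\<Sum>j=1..n. F \<omega> * of_real (X j \<omega>) * G j \<omega> * H \<omega>)
          = (\<Sum>j=1..n. if j = U n \<omega> then F \<omega> * of_real (X j \<omega>) * H \<omega> else 0)"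
        by (intro sum.cong) (auto simp: G_def)
      also have "\<dots> = F \<omega> * of_real (X (U n \<omega>) \<omega>) * H \<omega>"
        using elim(2) by simp
      also have "\<dots> = F \<omega> * of_real (X (Suc n) \<omega>)"
        using elim(1) by (simp add: H_def)
      finally show ?case ..
    qed
  qed
  also have "\<dots> = (\<Sum>j=1..n. \<integral>\<omega>. F \<omega> * of_real (X j \<omega>) * G j \<omega> * H \<omega> \<partial>M)"
    by (rule Bochner_Integration.integral_sum) (rule split(1))
  also have "\<dots> = (\<Sum>j=1..n. of_real ((2 * p - 1) / real n) * (\<integral>\<omega>. F \<omega> * of_real (X j \<omega>) \<partial>M))"
    by (intro sum.cong refl) (simp add: split(2) EG EH)
  also have "\<dots> = of_real ((2 * p - 1) / real n) * (\<integral>\<omega>. (\<Sum>j=1..n. F \<omega> * of_real (X j \<omega>)) \<partial>M)"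
    by (subst Bochner_Integration.integral_sum) (auto simp: FX sum_distrib_left)
  also have "\<dots> = (\<integral>\<omega>. of_real ((2 * p - 1) / real n) * (\<Sum>j=1..n. F \<omega> * of_real (X j \<omega>)) \<partial>M)"
    by simp
  also have "\<dots> = (\<integral>\<omega>. F \<omega> * of_real ((2 * p - 1) / real n * walk X n \<omega>) \<partial>M)"
    unfolding walk_def of_real_mult of_real_sum sum_distrib_left by (simp only: mult_ac)
  finally show ?thesis .
qed

lemma walk_Suc: "walk X (Suc n) \<omega> = walk X n \<omega> + X (Suc n) \<omega>"
  by (simp add: walk_def)

lemma integrable_walk: "integrable M (walk X n)"
  using integrable_bounded_function_of_walk[of "\<lambda>x. x" n "real n"] by simp

lemma integrable_walk_square: "integrable M (\<lambda>\<omega>. (walk X n \<omega>)\<^sup>2)"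
proof -
  have "x\<^sup>2 \<le> (real n)\<^sup>2" if "\<bar>x\<bar> \<le> real n" for x :: real
    using power_mono[OF that, of 2] by simp
  then show ?thesis
    using integrable_bounded_function_of_walk[of "\<lambda>x. x\<^sup>2" n "(real n)\<^sup>2"] by simp
qed

lemma integrable_step: "n \<ge> 1 \<Longrightarrow> integrable M (X n)"
  by (rule integrable_const_bound[of _ 1]) (use AE_abs_step[of n] X_measurable[of n] in auto)

lemma walk_mean_Suc:
  assumes "n \<ge> 1"
  shows "(\<integral>\<omega>. walk X (Suc n) \<omega> \<partial>M) = (1 + (2 * p - 1) / real n) * (\<integral>\<omega>. walk X n \<omega> \<partial>M)"
proof -
  have "(\<integral>\<omega>. 1 * complex_of_real (X (Suc n) \<omega>) \<partial>M)
      = (\<integral>\<omega>. 1 * of_real ((2 * p - 1) / real n * walk X n \<omega>) \<partial>M)"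
    by (intro next_step_expectation assms) auto
  also have "\<dots> = of_real ((2 * p - 1) / real n * (\<integral>\<omega>. walk X n \<omega> \<partial>M))"
    by (simp only: mult_1 integral_complex_of_real integral_mult_right_zero)
  finally have "complex_of_real (\<integral>\<omega>. X (Suc n) \<omega> \<partial>M)
      = of_real ((2 * p - 1) / real n * (\<integral>\<omega>. walk X n \<omega> \<partial>M))"
    by (simp only: mult_1 integral_complex_of_real)
  then have "(\<integral>\<omega>. X (Suc n) \<omega> \<partial>M) = (2 * p - 1) / real n * (\<integral>\<omega>. walk X n \<omega> \<partial>M)"
    by (simp only: of_real_eq_iff)
  then show ?thesis
    using integrable_walk[of n] integrable_step[of "Suc n"]
    by (simp only: walk_Suc Bochner_Integration.integral_add distrib_right mult_1)
qed

lemma second_moment_Suc: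
  assumes "n \<ge> 1"
  shows "(\<integral>\<omega>. (walk X (Suc n) \<omega>)\<^sup>2 \<partial>M) = (1 + 2 * (2 * p - 1) / real n) * (\<integral>\<omega>. (walk X n \<omega>)\<^sup>2 \<partial>M) + 1"
proof -
  have i: "integrable M (\<lambda>\<omega>. walk X n \<omega> * X (Suc n) \<omega>)"
    using integrable_times_step[of "\<lambda>\<omega>. of_real (walk X n \<omega>)" "Suc n"] integrable_walk[of n]
    by (simp flip: of_real_mult add: complex_of_real_integrable_eq)
  have "(\<integral>\<omega>. of_real (walk X n \<omega>) * complex_of_real (X (Suc n) \<omega>) \<partial>M)
      = (\<integral>\<omega>. of_real (walk X n \<omega>) * of_real ((2 * p - 1) / real n * walk X n \<omega>) \<partial>M)"
    using integrable_walk[of n] walk_measurable_past[of n] by (intro next_step_expectation assms) auto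
  also have "\<dots> = (\<integral>\<omega>. of_real ((2 * p - 1) / real n * (walk X n \<omega>)\<^sup>2) \<partial>M)"
    by (simp add: power2_eq_square mult.left_commute)
  also have "\<dots> = of_real (\<integral>\<omega>. (2 * p - 1) / real n * (walk X n \<omega>)\<^sup>2 \<partial>M)"
    by (rule integral_complex_of_real)
  also have "\<dots> = of_real ((2 * p - 1) / real n * (\<integral>\<omega>. (walk X n \<omega>)\<^sup>2 \<partial>M))"
    by (subst integral_mult_right_zero) simp
  finally have "complex_of_real (\<integral>\<omega>. walk X n \<omega> * X (Suc n) \<omega> \<partial>M)
      = of_real ((2 * p - 1) / real n * (\<integral>\<omega>. (walk X n \<omega>)\<^sup>2 \<partial>M))"
    by (simp only: of_real_mult[symmetric] integral_complex_of_real)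
  then have c: "(\<integral>\<omega>. walk X n \<omega> * X (Suc n) \<omega> \<partial>M) = (2 * p - 1) / real n * (\<integral>\<omega>. (walk X n \<omega>)\<^sup>2 \<partial>M)"
    by (simp only: of_real_eq_iff)
  have "(\<integral>\<omega>. (walk X (Suc n) \<omega>)\<^sup>2 \<partial>M)
      = (\<integral>\<omega>. (walk X n \<omega>)\<^sup>2 + 2 * (walk X n \<omega> * X (Suc n) \<omega>) + 1 \<partial>M)"
  proof (rule integral_cong_AE)
    have [measurable]: "X (Suc n) \<in> borel_measurable M" by (rule X_measurable) simp
    show "(\<lambda>\<omega>. (walk X n \<omega>)\<^sup>2 + 2 * (walk X n \<omega> * X (Suc n) \<omega>) + 1) \<in> borel_measurable M" by measurable
    show "AE \<omega> in M. (walk X (Suc n) \<omega>)\<^sup>2 = (walk X n \<omega>)\<^sup>2 + 2 * (walk X n \<omega> * X (Suc n) \<omega>) + 1"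
      using AE_abs_step[of "Suc n", simplified]
    proof eventually_elim
      case (elim \<omega>)
      then have "(X (Suc n) \<omega>)\<^sup>2 = 1"
        using power2_abs[of "X (Suc n) \<omega>"] by simp
      then show ?case by (simp add: walk_Suc power2_sum)
    qed
  qed measurable
  also have "\<dots> = (\<integral>\<omega>. (walk X n \<omega>)\<^sup>2 \<partial>M) + 2 * (\<integral>\<omega>. walk X n \<omega> * X (Suc n) \<omega> \<partial>M) + 1"
    using i integrable_walk_square[of n] by (simp add: prob_space)
  also have "\<dots> = (1 + 2 * (2 * p - 1) / real n) * (\<integral>\<omega>. (walk X n \<omega>)\<^sup>2 \<partial>M) + 1"
    unfolding c using assms by (simp add: field_simps)
  finally show ?thesis .
qed

text \<open>With \<open>\<alpha> \<le> 1/2\<close> the recursion for the second moment is dominated by that of \<open>n * H n\<close> with the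
  harmonic numbers \<open>H n\<close>. This is crude for \<open>\<alpha> < 1/2\<close>, but still \<open>o(n\<^sup>2)\<close>.\<close>

lemma second_moment_bound:
  assumes "p \<le> 3/4" "n \<ge> 1"
  shows "(\<integral>\<omega>. (walk X n \<omega>)\<^sup>2 \<partial>M) \<le> real n * (\<Sum>k=1..n. 1 / real k)"
  using assms(2)
proof (induction n rule: dec_induct)
  case base
  have "(\<integral>\<omega>. (walk X 1 \<omega>)\<^sup>2 \<partial>M) \<le> (\<integral>\<omega>. 1 \<partial>M)"
  proof (rule integral_mono_AE)
    show "AE \<omega> in M. (walk X 1 \<omega>)\<^sup>2 \<le> 1"
      using AE_abs_walk[of 1] by eventually_elim (simp add: abs_square_le_1)
  qed (use integrable_walk_square in auto)
  then show ?case by (simp add: prob_space)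
next
  case (step n)
  let ?e = "\<lambda>n. \<integral>\<omega>. (walk X n \<omega>)\<^sup>2 \<partial>M"
  have n: "real n \<ge> 1" using step by simp
  have "?e (Suc n) \<le> (1 + 1 / real n) * ?e n + 1"
    unfolding second_moment_Suc[OF step(1)] using assms(1) n
    by (intro add_mono mult_right_mono order_refl) (auto simp: divide_right_mono)
  also have "\<dots> \<le> (1 + 1 / real n) * (real n * (\<Sum>k=1..n. 1 / real k)) + 1"
    using step n by (intro add_mono mult_left_mono) auto
  also have "\<dots> = real (Suc n) * (\<Sum>k=1..Suc n. 1 / real k)"
    using n by (simp add: field_simps)
  finally show ?case .
qed

lemma second_moment_negligible:
  assumes "p \<le> 3/4"
  shows "(\<lambda>n. (\<integral>\<omega>. (walk X n \<omega>)\<^sup>2 \<partial>M) / (real n)\<^sup>2) \<longlonglongrightarrow> 0"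
proof (rule tendsto_sandwich)
  show "eventually (\<lambda>n. 0 \<le> (\<integral>\<omega>. (walk X n \<omega>)\<^sup>2 \<partial>M) / (real n)\<^sup>2) sequentially"
    by simp
  show "eventually (\<lambda>n. (\<integral>\<omega>. (walk X n \<omega>)\<^sup>2 \<partial>M) / (real n)\<^sup>2
      \<le> (\<Sum>k=1..<n. 1 / real k) / real n + 1 / real n * (1 / real n)) sequentially"
    using eventually_ge_at_top[of 1]
  proof eventually_elim
    case (elim n)
    have "(\<Sum>k=1..n. 1 / real k) = (\<Sum>k=1..<n. 1 / real k) + 1 / real n"
      using elim by (cases n) (auto simp: atLeastLessThanSuc_atLeastAtMost)
    then show ?case
      using second_moment_bound[OF assms elim] elim by (simp add: field_simps power2_eq_square)
  qed
  show "(\<lambda>n. (\<Sum>k=1..<n. 1 / real k) / real n + 1 / real n * (1 / real n)) \<longlonglongrightarrow> 0"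
    using tendsto_add[OF harmonic_average_tendsto_0 tendsto_mult[OF lim_1_over_n lim_1_over_n]] by simp
qed simp

end

section \<open>Characteristic functions of the Gaussian and of a centred sign\<close>

text \<open>Reduces the characteristic function of a centred Gaussian to that of the standard normal law.\<close>

lemma gaussian_eq_distr:
  assumes "v > 0"
  shows "gaussian 0 v = distr std_normal_distribution borel (\<lambda>x. sqrt v * x)"
proof -
  interpret std: prob_space std_normal_distribution
    using prob_space_normal_density by auto
  have "distributed std_normal_distribution lborel (\<lambda>x. x) (normal_density 0 1)"
    unfolding distributed_def by (auto intro!: distr_id2)
  from std.normal_density_affine[OF this, of "sqrt v" 0] assms
  have "distr std_normal_distribution lborel (\<lambda>x. sqrt v * x) = gaussian 0 v"
    by (simp add: distributed_def gaussian_def)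
  moreover have "distr std_normal_distribution lborel (\<lambda>x. sqrt v * x)
      = distr std_normal_distribution borel (\<lambda>x. sqrt v * x)"
    by (intro distr_cong) auto
  ultimately show ?thesis by simp
qed

lemma real_distribution_gaussian: "v > 0 \<Longrightarrow> real_distribution (gaussian 0 v)"
  unfolding gaussian_eq_distr
  using prob_space_normal_density by (intro prob_space.real_distribution_distr) auto

lemma char_gaussian:
  assumes "v > 0"
  shows "char (gaussian 0 v) t = of_real (exp (- (v * t\<^sup>2 / 2)))"
proof -
  have "char (gaussian 0 v) t = char std_normal_distribution (t * sqrt v)"
    unfolding gaussian_eq_distr[OF assms] char_def
    by (subst integral_distr) (auto simp: mult.assoc)
  then show ?thesis
    using assms by (simp add: char_std_normal_distribution power_mult_distrib mult.commute)
qed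

lemma exp_minus_linear_error:
  fixes x :: real
  assumes "x \<ge> 0"
  shows "\<bar>1 - x - exp (-x)\<bar> \<le> x\<^sup>2 / 2"
proof -
  have pos: "1 - x + x\<^sup>2 / 2 \<ge> 0"
    using zero_le_power2[of "1 - x"] by (simp add: power2_eq_square algebra_simps)
  have "1 \<le> (1 - x + x\<^sup>2 / 2) * (1 + x + x\<^sup>2 / 2)"
  proof -
    have "(1 - x + x\<^sup>2 / 2) * (1 + x + x\<^sup>2 / 2) = 1 + (x\<^sup>2)\<^sup>2 / 4"
      by (simp add: power2_eq_square algebra_simps)
    then show ?thesis by simp
  qed
  also have "\<dots> \<le> (1 - x + x\<^sup>2 / 2) * exp x"
    using exp_lower_Taylor_quadratic[OF assms] pos by (intro mult_left_mono)
  finally have "exp (-x) \<le> 1 - x + x\<^sup>2 / 2"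
    by (simp add: exp_minus field_simps)
  moreover have "1 - x \<le> exp (-x)"
    using exp_ge_add_one_self[of "-x"] by simp
  ultimately show ?thesis by simp
qed

text \<open>The first term under the norm is the characteristic function at \<open>b\<close> of \<open>\<xi> - m\<close>, where \<open>\<xi>\<close> is a random
  sign of mean \<open>m\<close>. This variable is centred, bounded by 2 and has variance \<open>1 - m\<^sup>2\<close>, so Taylor's
  formula gives \<open>1 - b\<^sup>2 * (1 - m\<^sup>2) / 2\<close> up to \<open>(2 * \<bar>b\<bar>) ^ 3 / 6\<close>.\<close>

lemma centred_sign_char_error:
  fixes b m :: real
  assumes "\<bar>m\<bar> \<le> 1"
  shows "cmod (iexp (- (b * m)) * (of_real (cos b) + \<i> * of_real (m * sin b)) - of_real (1 - b\<^sup>2 / 2))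
      \<le> b\<^sup>2 * m\<^sup>2 / 2 + 4 / 3 * \<bar>b\<bar> ^ 3"
proof -
  define R where "R x = iexp x - (1 + \<i> * of_real x - of_real (x\<^sup>2 / 2))" for x :: real
  have R: "cmod (R x) \<le> \<bar>x\<bar> ^ 3 / 6" for x
  proof -
    have "(\<Sum>k\<le>2. (\<i> * of_real x) ^ k / fact k) = 1 + \<i> * of_real x - of_real (x\<^sup>2 / 2)"
      by (simp add: numeral_2_eq_2 power_mult_distrib)
    then show ?thesis
      using iexp_approx1[of x 2] by (simp add: R_def fact_numeral)
  qed
  have R2: "cmod (R x) \<le> 4 / 3 * \<bar>b\<bar> ^ 3" if "\<bar>x\<bar> \<le> 2 * \<bar>b\<bar>" for x
  proof -
    have "\<bar>x\<bar> ^ 3 \<le> (2 * \<bar>b\<bar>) ^ 3" using that by (intro power_mono) auto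
    then show ?thesis using R[of x] by (simp add: power_mult_distrib)
  qed
  \<comment> \<open>The two values of the centred sign, scaled by \<open>b\<close>, have probabilities
    \<open>(1 + m) / 2\<close> and \<open>(1 - m) / 2\<close>; in the mixture of the Taylor polynomials the linear terms cancel.\<close>
  let ?x = "b * (1 - m)" and ?y = "- (b * (1 + m))"
  have "iexp (- (b * m)) * (of_real (cos b) + \<i> * of_real (m * sin b))
      = of_real ((1 + m) / 2) * iexp ?x + of_real ((1 - m) / 2) * iexp ?y"
  proof -
    have x: "iexp ?x = iexp (- (b * m)) * iexp b"
      by (simp add: exp_add[symmetric] algebra_simps)
    have y: "iexp ?y = iexp (- (b * m)) * iexp (- b)"
      by (simp add: exp_add[symmetric] algebra_simps)
    have e: "iexp b = of_real (cos b) + \<i> * of_real (sin b)"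
      "iexp (- b) = of_real (cos b) - \<i> * of_real (sin b)"
      by (auto simp: complex_eq_iff Re_exp Im_exp)
    show ?thesis unfolding x y unfolding e by (simp add: field_simps)
  qed
  also have "\<dots> = of_real ((1 + m) / 2) * R ?x + of_real ((1 - m) / 2) * R ?y
      + of_real (1 - b\<^sup>2 / 2 + b\<^sup>2 * m\<^sup>2 / 2)"
    unfolding R_def by (simp add: field_simps power2_eq_square)
  finally have "cmod (iexp (- (b * m)) * (of_real (cos b) + \<i> * of_real (m * sin b)) - of_real (1 - b\<^sup>2 / 2))
      = cmod (of_real ((1 + m) / 2) * R ?x + of_real ((1 - m) / 2) * R ?y + of_real (b\<^sup>2 * m\<^sup>2 / 2))"
    by (simp add: algebra_simps)
  also have "\<dots> \<le> cmod (of_real ((1 + m) / 2) * R ?x) + cmod (of_real ((1 - m) / 2) * R ?y)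
      + cmod (of_real (b\<^sup>2 * m\<^sup>2 / 2))"
    by (intro order_trans[OF norm_triangle_ineq] add_mono norm_triangle_ineq order_refl)
  also have "\<dots> = (1 + m) / 2 * cmod (R ?x) + (1 - m) / 2 * cmod (R ?y) + b\<^sup>2 * m\<^sup>2 / 2"
    using assms unfolding norm_mult norm_of_real by simp
  also have "\<dots> \<le> (1 + m) / 2 * (4 / 3 * \<bar>b\<bar> ^ 3) + (1 - m) / 2 * (4 / 3 * \<bar>b\<bar> ^ 3) + b\<^sup>2 * m\<^sup>2 / 2"
    using assms by (intro add_mono mult_left_mono R2 order_refl)
      (auto simp: abs_mult mult.commute[of 2] intro!: mult_left_mono)
  also have "\<dots> = b\<^sup>2 * m\<^sup>2 / 2 + 4 / 3 * \<bar>b\<bar> ^ 3"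
    by (simp add: field_simps)
  finally show ?thesis .
qed

section \<open>Central limit theorem\<close>

context elephant_random_walk
begin

definition normed_char :: "nat \<Rightarrow> real \<Rightarrow> complex" where
  "normed_char n u = (\<integral>\<omega>. iexp (u * norming (2 * p - 1) n * walk X n \<omega>) \<partial>M)"

text \<open>Up to the factor \<open>\<alpha>\<^sup>2\<close>, this is how much the mean conditional variance of a step falls short of 1.\<close>

definition mean_square_speed :: "nat \<Rightarrow> real" where
  "mean_square_speed n = (\<integral>\<omega>. (walk X n \<omega>)\<^sup>2 \<partial>M) / (real n)\<^sup>2"

lemma mean_square_speed_nonneg: "mean_square_speed n \<ge> 0"
  unfolding mean_square_speed_def by simp

lemma integrable_iexp_walk: "integrable M (\<lambda>\<omega>. iexp (s * walk X n \<omega>))"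
  by (rule integrable_bounded_function_of_walk[of "\<lambda>x. iexp (s * x)" n 1]) auto

lemma norm_normed_char_le_1: "cmod (normed_char n u) \<le> 1"
proof -
  have "cmod (normed_char n u) \<le> (\<integral>\<omega>. cmod (iexp (u * norming (2 * p - 1) n * walk X n \<omega>)) \<partial>M)"
    unfolding normed_char_def by (rule integral_norm_bound)
  then show ?thesis by (simp add: prob_space)
qed

text \<open>Conditionally on the past, the increment of the normed walk is \<open>norming \<alpha> (n + 1)\<close> times a sign
  minus its conditional mean \<open>m = \<alpha> / n * S n\<close>. The one-step error is \<open>\<Delta>\<close>, which multiplies the
  unimodular variable \<open>\<Phi>\<close>; the random part \<open>m\<^sup>2\<close> of the variance is small on average because
  \<open>S n / n\<close> is small in mean square.\<close>

lemma normed_char_Suc: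
  fixes u :: real
  assumes "n \<ge> 1" "0 < p" "p \<le> 3/4"
  defines "b \<equiv> u * norming (2 * p - 1) (Suc n)"
  shows "cmod (normed_char (Suc n) u - of_real (1 - b\<^sup>2 / 2) * normed_char n u)
      \<le> b\<^sup>2 * mean_square_speed n / 2 + 4 / 3 * \<bar>b\<bar> ^ 3"
proof -
  define \<alpha> where "\<alpha> = 2 * p - 1"
  have \<alpha>: "-1 < \<alpha>" "\<bar>\<alpha>\<bar> \<le> 1" using assms by (auto simp: \<alpha>_def)
  define m where "m \<omega> = \<alpha> / real n * walk X n \<omega>" for \<omega>
  define \<Phi> where "\<Phi> \<omega> = iexp (u * norming \<alpha> n * walk X n \<omega>)" for \<omega>
  define \<Delta> where "\<Delta> \<omega> = iexp (- (b * m \<omega>)) * (of_real (cos b) + \<i> * of_real (m \<omega> * sin b)) - of_real (1 - b\<^sup>2 / 2)" for \<omega>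
  have [measurable]: "m \<in> borel_measurable M" unfolding m_def[abs_def] by measurable
  have [measurable]: "\<Phi> \<in> borel_measurable M" unfolding \<Phi>_def[abs_def] by measurable
  have [measurable]: "\<Delta> \<in> borel_measurable M" unfolding \<Delta>_def[abs_def] by measurable
  have iF: "integrable M (\<lambda>\<omega>. iexp (b * walk X n \<omega>))"
    by (rule integrable_iexp_walk)
  have mF: "(\<lambda>\<omega>. iexp (b * walk X n \<omega>)) \<in> borel_measurable (information n Past)"
    using walk_measurable_past[of n] by measurable
  have iFX: "integrable M (\<lambda>\<omega>. iexp (b * walk X n \<omega>) * of_real (X (Suc n) \<omega>))"
    using integrable_times_step[OF iF] by simp
  have abs_m: "AE \<omega> in M. \<bar>m \<omega>\<bar> \<le> 1 \<and> (m \<omega>)\<^sup>2 \<le> (walk X n \<omega>)\<^sup>2 / (real n)\<^sup>2"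
    using AE_abs_walk[of n]
  proof eventually_elim
    case (elim \<omega>)
    have "\<bar>m \<omega>\<bar> = \<bar>\<alpha>\<bar> * (\<bar>walk X n \<omega>\<bar> / real n)"
      by (simp add: m_def abs_mult)
    also have "\<dots> \<le> \<bar>walk X n \<omega>\<bar> / real n"
      using \<alpha> by (intro mult_left_le_one_le) auto
    finally have *: "\<bar>m \<omega>\<bar> \<le> \<bar>walk X n \<omega>\<bar> / real n" .
    have "\<bar>m \<omega>\<bar>\<^sup>2 \<le> (\<bar>walk X n \<omega>\<bar> / real n)\<^sup>2"
      using * by (intro power_mono) auto
    moreover have "\<bar>walk X n \<omega>\<bar> / real n \<le> 1" using elim assms(1) by simp
    ultimately show ?case using * by (simp add: power_divide)
  qed
  \<comment> \<open>The next step is a sign, so its exponential is an affine function of it.\<close>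
  have "normed_char (Suc n) u
      = (\<integral>\<omega>. of_real (cos b) * iexp (b * walk X n \<omega>)
          + \<i> * of_real (sin b) * (iexp (b * walk X n \<omega>) * of_real (X (Suc n) \<omega>)) \<partial>M)"
    unfolding normed_char_def
  proof (rule integral_cong_AE)
    have [measurable]: "X (Suc n) \<in> borel_measurable M" by (rule X_measurable) simp
    show "(\<lambda>\<omega>. of_real (cos b) * iexp (b * walk X n \<omega>)
        + \<i> * of_real (sin b) * (iexp (b * walk X n \<omega>) * of_real (X (Suc n) \<omega>))) \<in> borel_measurable M"
      by measurable
    show "AE \<omega> in M. iexp (u * norming (2 * p - 1) (Suc n) * walk X (Suc n) \<omega>)
        = of_real (cos b) * iexp (b * walk X n \<omega>)
        + \<i> * of_real (sin b) * (iexp (b * walk X n \<omega>) * of_real (X (Suc n) \<omega>))"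
      using AE_abs_step[of "Suc n", simplified]
    proof eventually_elim
      case (elim \<omega>)
      then have "X (Suc n) \<omega> = 1 \<or> X (Suc n) \<omega> = -1" by linarith
      then have "iexp (b * X (Suc n) \<omega>) = of_real (cos b) + \<i> * of_real (sin b) * of_real (X (Suc n) \<omega>)"
        by (auto simp: complex_eq_iff Re_exp Im_exp)
      moreover have "iexp (b * walk X (Suc n) \<omega>) = iexp (b * walk X n \<omega>) * iexp (b * X (Suc n) \<omega>)"
        by (simp add: walk_Suc exp_add[symmetric] algebra_simps)
      ultimately show ?case
        unfolding b_def[symmetric] by (simp add: algebra_simps)
    qed
  qed measurable
  also have "\<dots> = of_real (cos b) * (\<integral>\<omega>. iexp (b * walk X n \<omega>) \<partial>M)
      + \<i> * of_real (sin b) * (\<integral>\<omega>. iexp (b * walk X n \<omega>) * of_real (X (Suc n) \<omega>) \<partial>M)"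
    using iF iFX by (subst Bochner_Integration.integral_add) auto
  also have "(\<integral>\<omega>. iexp (b * walk X n \<omega>) * of_real (X (Suc n) \<omega>) \<partial>M)
      = (\<integral>\<omega>. iexp (b * walk X n \<omega>) * of_real (m \<omega>) \<partial>M)"
    unfolding m_def \<alpha>_def by (rule next_step_expectation[OF assms(1) mF iF])
  also have "of_real (cos b) * (\<integral>\<omega>. iexp (b * walk X n \<omega>) \<partial>M)
      + \<i> * of_real (sin b) * (\<integral>\<omega>. iexp (b * walk X n \<omega>) * of_real (m \<omega>) \<partial>M)
      = (\<integral>\<omega>. of_real (cos b) * iexp (b * walk X n \<omega>)
          + \<i> * of_real (sin b) * (iexp (b * walk X n \<omega>) * of_real (m \<omega>)) \<partial>M)"
  proof -
    have "integrable M (\<lambda>\<omega>. iexp (b * walk X n \<omega>) * of_real (m \<omega>))"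
    proof (rule integrable_const_bound)
      show "AE \<omega> in M. cmod (iexp (b * walk X n \<omega>) * of_real (m \<omega>)) \<le> 1"
        using abs_m by eventually_elim (simp add: norm_mult)
    qed measurable
    then show ?thesis using iF by (subst Bochner_Integration.integral_add) auto
  qed
  also have "\<dots> = (\<integral>\<omega>. \<Phi> \<omega> * (\<Delta> \<omega> + of_real (1 - b\<^sup>2 / 2)) \<partial>M)"
  proof (rule Bochner_Integration.integral_cong[OF refl])
    fix \<omega>
    \<comment> \<open>The norming recursion moves the conditional mean \<open>m\<close> into the exponent of the past.\<close>
    have "u * norming \<alpha> n * walk X n \<omega> = b * walk X n \<omega> + b * m \<omega>"
      using norming_Suc[OF \<alpha>(1) assms(1)] by (simp add: b_def m_def \<alpha>_def algebra_simps)
    then have "\<Phi> \<omega> * iexp (- (b * m \<omega>)) = iexp (b * walk X n \<omega>)"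
      by (simp add: \<Phi>_def exp_add[symmetric] algebra_simps)
    then have "iexp (b * walk X n \<omega>) * (of_real (cos b) + \<i> * of_real (m \<omega> * sin b))
        = \<Phi> \<omega> * (\<Delta> \<omega> + of_real (1 - b\<^sup>2 / 2))"
      unfolding \<Delta>_def by (simp add: mult.assoc[symmetric])
    then show "of_real (cos b) * iexp (b * walk X n \<omega>)
        + \<i> * of_real (sin b) * (iexp (b * walk X n \<omega>) * of_real (m \<omega>))
        = \<Phi> \<omega> * (\<Delta> \<omega> + of_real (1 - b\<^sup>2 / 2))"
      by (simp add: algebra_simps)
  qed
  finally have eq: "normed_char (Suc n) u = (\<integral>\<omega>. \<Phi> \<omega> * (\<Delta> \<omega> + of_real (1 - b\<^sup>2 / 2)) \<partial>M)" .
  have \<Delta>: "AE \<omega> in M. cmod (\<Delta> \<omega>) \<le> b\<^sup>2 * ((walk X n \<omega>)\<^sup>2 / (real n)\<^sup>2) / 2 + 4 / 3 * \<bar>b\<bar> ^ 3"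
    using abs_m
  proof eventually_elim
    case (elim \<omega>)
    have "cmod (\<Delta> \<omega>) \<le> b\<^sup>2 * (m \<omega>)\<^sup>2 / 2 + 4 / 3 * \<bar>b\<bar> ^ 3"
      unfolding \<Delta>_def by (rule centred_sign_char_error) (use elim in auto)
    also have "\<dots> \<le> b\<^sup>2 * ((walk X n \<omega>)\<^sup>2 / (real n)\<^sup>2) / 2 + 4 / 3 * \<bar>b\<bar> ^ 3"
      using elim by (intro add_mono divide_right_mono mult_left_mono) auto
    finally show ?case .
  qed
  have bound: "integrable M (\<lambda>\<omega>. b\<^sup>2 * ((walk X n \<omega>)\<^sup>2 / (real n)\<^sup>2) / 2 + 4 / 3 * \<bar>b\<bar> ^ 3)"
    using integrable_walk_square[of n] by auto
  have i\<Phi>: "integrable M \<Phi>"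
    unfolding \<Phi>_def[abs_def] by (rule integrable_iexp_walk)
  have norm_\<Phi>\<Delta>: "cmod (\<Phi> \<omega> * \<Delta> \<omega>) = cmod (\<Delta> \<omega>)" for \<omega>
    unfolding norm_mult \<Phi>_def by simp
  have i\<Phi>\<Delta>: "integrable M (\<lambda>\<omega>. \<Phi> \<omega> * \<Delta> \<omega>)"
  proof (rule Bochner_Integration.integrable_bound[OF bound])
    show "AE \<omega> in M. cmod (\<Phi> \<omega> * \<Delta> \<omega>)
        \<le> norm (b\<^sup>2 * ((walk X n \<omega>)\<^sup>2 / (real n)\<^sup>2) / 2 + 4 / 3 * \<bar>b\<bar> ^ 3)"
      using \<Delta> by eventually_elim (simp add: norm_\<Phi>\<Delta>)
  qed measurable
  have "normed_char (Suc n) u = (\<integral>\<omega>. \<Phi> \<omega> * \<Delta> \<omega> + of_real (1 - b\<^sup>2 / 2) * \<Phi> \<omega> \<partial>M)"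
    unfolding eq by (intro Bochner_Integration.integral_cong refl) (simp add: algebra_simps)
  also have "\<dots> = (\<integral>\<omega>. \<Phi> \<omega> * \<Delta> \<omega> \<partial>M) + of_real (1 - b\<^sup>2 / 2) * (\<integral>\<omega>. \<Phi> \<omega> \<partial>M)"
    using i\<Phi>\<Delta> i\<Phi> by (subst Bochner_Integration.integral_add) auto
  also have "(\<integral>\<omega>. \<Phi> \<omega> \<partial>M) = normed_char n u"
    unfolding normed_char_def \<Phi>_def \<alpha>_def ..
  finally have "cmod (normed_char (Suc n) u - of_real (1 - b\<^sup>2 / 2) * normed_char n u)
      = cmod (\<integral>\<omega>. \<Phi> \<omega> * \<Delta> \<omega> \<partial>M)"
    by simp
  also have "\<dots> \<le> (\<integral>\<omega>. cmod (\<Phi> \<omega> * \<Delta> \<omega>) \<partial>M)"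
    by (rule integral_norm_bound)
  also have "\<dots> \<le> (\<integral>\<omega>. b\<^sup>2 * ((walk X n \<omega>)\<^sup>2 / (real n)\<^sup>2) / 2 + 4 / 3 * \<bar>b\<bar> ^ 3 \<partial>M)"
    using \<Delta> by (intro integral_mono_AE bound integrable_norm i\<Phi>\<Delta>) (simp add: norm_\<Phi>\<Delta>)
  also have "\<dots> = b\<^sup>2 * mean_square_speed n / 2 + 4 / 3 * \<bar>b\<bar> ^ 3"
    using integrable_walk_square[of n]
    by (subst Bochner_Integration.integral_add) (auto simp: mean_square_speed_def prob_space)
  finally show ?thesis .
qed

lemma normed_char_Suc_exp:
  fixes u :: real
  assumes "n \<ge> 1" "0 < p" "p \<le> 3/4"
  defines "b \<equiv> u * norming (2 * p - 1) (Suc n)"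
  shows "cmod (normed_char (Suc n) u - of_real (exp (- (b\<^sup>2 / 2))) * normed_char n u)
      \<le> b\<^sup>2 * mean_square_speed n / 2 + 4 / 3 * \<bar>b\<bar> ^ 3 + b ^ 4 / 8"
proof -
  have "cmod (normed_char (Suc n) u - of_real (exp (- (b\<^sup>2 / 2))) * normed_char n u)
      = cmod ((normed_char (Suc n) u - of_real (1 - b\<^sup>2 / 2) * normed_char n u)
          + of_real (1 - b\<^sup>2 / 2 - exp (- (b\<^sup>2 / 2))) * normed_char n u)"
    by (simp add: algebra_simps)
  also have "\<dots> \<le> cmod (normed_char (Suc n) u - of_real (1 - b\<^sup>2 / 2) * normed_char n u)
      + cmod (of_real (1 - b\<^sup>2 / 2 - exp (- (b\<^sup>2 / 2))) * normed_char n u)"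
    by (rule norm_triangle_ineq)
  also have "cmod (of_real (1 - b\<^sup>2 / 2 - exp (- (b\<^sup>2 / 2))) * normed_char n u)
      \<le> \<bar>1 - b\<^sup>2 / 2 - exp (- (b\<^sup>2 / 2))\<bar>"
    unfolding norm_mult norm_of_real by (rule mult_left_le) (auto simp: norm_normed_char_le_1)
  also have "\<dots> \<le> (b\<^sup>2 / 2)\<^sup>2 / 2"
    by (rule exp_minus_linear_error) simp
  also have "\<dots> = b ^ 4 / 8"
    by (simp add: power_divide flip: power_mult)
  finally show ?thesis
    using normed_char_Suc[OF assms(1-3), of u] unfolding b_def by simp
qed

text \<open>Hence subtracting the mean of the walk only multiplies the characteristic function of the normed
  walk by a fixed character.\<close>

lemma normed_mean_constant:
  assumes "0 < p" "n \<ge> 1"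
  shows "norming (2 * p - 1) n * (\<integral>\<omega>. walk X n \<omega> \<partial>M) = (\<integral>\<omega>. X 1 \<omega> \<partial>M)"
  using assms(2)
proof (induction n rule: dec_induct)
  case base
  then show ?case by (simp add: norming_1 walk_def)
next
  case (step n)
  then show ?case
    using walk_mean_Suc[of n] norming_Suc[of "2 * p - 1" n] assms(1) by (simp add: mult.assoc)
qed

lemma normed_char_1_error:
  "cmod (normed_char 1 u - iexp (u * (\<integral>\<omega>. X 1 \<omega> \<partial>M))) \<le> 2 * \<bar>u\<bar>"
proof -
  let ?c = "\<integral>\<omega>. X 1 \<omega> \<partial>M"
  have X1: "integrable M (X 1)" by (rule integrable_step) simp
  have c: "\<bar>?c\<bar> \<le> 1"
  proof -
    have "\<bar>?c\<bar> \<le> (\<integral>\<omega>. \<bar>X 1 \<omega>\<bar> \<partial>M)" by (rule integral_abs_bound)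
    also have "\<dots> \<le> (\<integral>\<omega>. 1 \<partial>M)"
      using X1 AE_abs_step[of 1] by (intro integral_mono_AE integrable_abs) auto
    finally show ?thesis by (simp add: prob_space)
  qed
  have one: "normed_char 1 u = (\<integral>\<omega>. iexp (u * X 1 \<omega>) \<partial>M)"
    by (simp add: normed_char_def norming_1 walk_def)
  have i: "integrable M (\<lambda>\<omega>. iexp (u * X 1 \<omega>))"
    using integrable_iexp_walk[of u 1] by (simp add: walk_def)
  have "normed_char 1 u - iexp (u * ?c) = (\<integral>\<omega>. iexp (u * X 1 \<omega>) - iexp (u * ?c) \<partial>M)"
    unfolding one using i by (subst Bochner_Integration.integral_diff) (auto simp: prob_space)
  also have "cmod \<dots> \<le> (\<integral>\<omega>. cmod (iexp (u * X 1 \<omega>) - iexp (u * ?c)) \<partial>M)"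
    by (rule integral_norm_bound)
  also have "\<dots> \<le> (\<integral>\<omega>. 2 * \<bar>u\<bar> \<partial>M)"
  proof (rule integral_mono_AE)
    show "integrable M (\<lambda>\<omega>. cmod (iexp (u * X 1 \<omega>) - iexp (u * ?c)))"
      using i by (intro integrable_norm) auto
    show "AE \<omega> in M. cmod (iexp (u * X 1 \<omega>) - iexp (u * ?c)) \<le> 2 * \<bar>u\<bar>"
      using AE_abs_step[of 1, simplified]
    proof eventually_elim
      case (elim \<omega>)
      have "iexp (u * X 1 \<omega>) - iexp (u * ?c) = iexp (u * ?c) * (iexp (u * (X 1 \<omega> - ?c)) - 1)"
        by (simp add: right_diff_distrib exp_add[symmetric])
      then have "cmod (iexp (u * X 1 \<omega>) - iexp (u * ?c)) = cmod (iexp (u * (X 1 \<omega> - ?c)) - 1)"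
        by (simp add: norm_mult)
      also have "\<dots> \<le> \<bar>u * (X 1 \<omega> - ?c)\<bar>"
        using iexp_approx1[of "u * (X 1 \<omega> - ?c)" 0] by simp
      also have "\<dots> \<le> \<bar>u\<bar> * 2"
        unfolding abs_mult using elim c by (intro mult_left_mono) auto
      finally show ?case by simp
    qed
  qed simp
  finally show ?thesis by (simp add: prob_space)
qed

text \<open>The one-step errors add up, because the Gaussian factors by which they are propagated have
  modulus at most 1. The term \<open>2 * \<bar>u\<bar>\<close> comes from the first step, which has no Gaussian factor but is
  negligible for small \<open>u\<close>.\<close>

lemma normed_char_error:
  fixes u :: real
  assumes "0 < p" "p \<le> 3/4" "n \<ge> 1"
  defines "b \<equiv> \<lambda>k. u * norming (2 * p - 1) (Suc k)"
  shows "cmod (normed_char n u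
        - of_real (exp (- (u\<^sup>2 * variance_clock (2 * p - 1) n / 2))) * iexp (u * (\<integral>\<omega>. X 1 \<omega> \<partial>M)))
      \<le> 2 * \<bar>u\<bar> + (\<Sum>k=1..<n. (b k)\<^sup>2 * mean_square_speed k / 2 + 4 / 3 * \<bar>b k\<bar> ^ 3 + b k ^ 4 / 8)"
  using assms(3)
proof (induction n rule: dec_induct)
  case base
  then show ?case using normed_char_1_error[of u] by (simp add: variance_clock_def)
next
  case (step n)
  let ?V = "variance_clock (2 * p - 1)"
  let ?z = "iexp (u * (\<integral>\<omega>. X 1 \<omega> \<partial>M))"
  let ?g = "\<lambda>n. of_real (exp (- (u\<^sup>2 * ?V n / 2))) :: complex"
  let ?e = "\<lambda>k. (b k)\<^sup>2 * mean_square_speed k / 2 + 4 / 3 * \<bar>b k\<bar> ^ 3 + b k ^ 4 / 8"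
  let ?h = "of_real (exp (- ((b n)\<^sup>2 / 2))) :: complex"
  have g: "?g (Suc n) = ?h * ?g n"
    using variance_clock_Suc[of n "2 * p - 1"] step(1)
    by (simp add: b_def power_mult_distrib algebra_simps add_divide_distrib flip: of_real_mult exp_add)
  have "normed_char (Suc n) u - ?g (Suc n) * ?z
      = (normed_char (Suc n) u - ?h * normed_char n u) + ?h * (normed_char n u - ?g n * ?z)"
    unfolding g by (simp add: algebra_simps)
  then have "cmod (normed_char (Suc n) u - ?g (Suc n) * ?z)
      \<le> cmod (normed_char (Suc n) u - ?h * normed_char n u) + cmod (?h * (normed_char n u - ?g n * ?z))"
    by (simp only: norm_triangle_ineq)
  also have "cmod (normed_char (Suc n) u - ?h * normed_char n u) \<le> ?e n"
    unfolding b_def by (rule normed_char_Suc_exp[OF step(1) assms(1,2)])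
  also have "cmod (?h * (normed_char n u - ?g n * ?z)) \<le> cmod (normed_char n u - ?g n * ?z)"
    unfolding norm_mult norm_of_real by (rule mult_left_le_one_le) auto
  also have "\<dots> \<le> 2 * \<bar>u\<bar> + (\<Sum>k=1..<n. ?e k)"
    by (rule step.IH)
  finally show ?case using step(1) by simp
qed

text \<open>The weighted average of the two quantities that control a step: the variance defect and the size
  of the increment relative to the standard deviation accumulated so far.\<close>

definition relative_error :: "nat \<Rightarrow> real" where
  "relative_error n = (\<Sum>k=1..<n. (norming (2 * p - 1) (Suc k))\<^sup>2
      * (mean_square_speed k + norming (2 * p - 1) (Suc k) / sqrt (variance_clock (2 * p - 1) (Suc k))))
      / variance_clock (2 * p - 1) n"

lemma relative_error_tendsto_0:
  assumes "0 < p" "p \<le> 3/4"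
  shows "relative_error \<longlonglongrightarrow> 0"
proof -
  have "(\<lambda>k. mean_square_speed k + norming (2 * p - 1) (Suc k) / sqrt (variance_clock (2 * p - 1) (Suc k)))
      \<longlonglongrightarrow> 0 + 0"
    unfolding mean_square_speed_def using assms
    by (intro tendsto_add second_moment_negligible norming_negligible) auto
  moreover have "filterlim (variance_clock (2 * p - 1)) at_top sequentially"
    by (rule variance_clock_at_top) (use assms in auto)
  ultimately show ?thesis
    unfolding relative_error_def[abs_def] variance_clock_def[of _ n for n]
    by (intro weighted_cesaro) (auto simp: variance_clock_def[abs_def])
qed

text \<open>In the relevant range \<open>\<tau>\<close> stays bounded, so the accumulated error is of the order of
  \<open>relative_error n\<close>. The cubic and quartic error terms are absorbed by comparing the increment at
  \<open>k\<close> with the clock at time \<open>n\<close>, which is not less than the clock at \<open>k + 1\<close>.\<close>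

lemma summed_error_bound:
  fixes u :: real and n :: nat
  assumes "0 < p"
  defines "b \<equiv> \<lambda>k. u * norming (2 * p - 1) (Suc k)"
    and "\<tau> \<equiv> \<bar>u\<bar> * sqrt (variance_clock (2 * p - 1) n)"
  shows "(\<Sum>k=1..<n. (b k)\<^sup>2 * mean_square_speed k / 2 + 4 / 3 * \<bar>b k\<bar> ^ 3 + b k ^ 4 / 8)
      \<le> (\<tau>\<^sup>2 + 2 * \<tau> ^ 3 + \<tau> ^ 4) * relative_error n"
proof -
  let ?V = "variance_clock (2 * p - 1)" and ?a = "norming (2 * p - 1)"
  let ?r = mean_square_speed and ?z = "\<lambda>k. ?a (Suc k) / sqrt (?V (Suc k))"
  have a: "?a k > 0" for k using assms(1) by (intro norming_pos) auto
  have \<tau>0: "\<tau> \<ge> 0" unfolding \<tau>_def using variance_clock_nonneg by simp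
  have "(b k)\<^sup>2 * ?r k / 2 + 4 / 3 * \<bar>b k\<bar> ^ 3 + b k ^ 4 / 8
      \<le> (\<tau>\<^sup>2 + 2 * \<tau> ^ 3 + \<tau> ^ 4) * ((?a (Suc k))\<^sup>2 * (?r k + ?z k) / ?V n)"
    if k: "k \<in> {1..<n}" for k
  proof -
    define v where "v = ?V n"
    \<comment> \<open>The increment at \<open>k\<close> in units of the standard deviation at time \<open>n\<close>.\<close>
    define s where "s = ?a (Suc k) / sqrt v"
    have Vk: "?V (Suc k) \<ge> (?a (Suc k))\<^sup>2"
      using k variance_clock_Suc[of k "2 * p - 1"] variance_clock_nonneg[of "2 * p - 1" k] by simp
    have Vk0: "?V (Suc k) > 0" using a[of "Suc k"] by (intro less_le_trans[OF _ Vk]) simp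
    have Vn: "?V (Suc k) \<le> v" unfolding v_def using k by (intro variance_clock_mono) auto
    have v0: "v > 0" using Vk0 Vn by linarith
    have s0: "s > 0" using a v0 by (simp add: s_def)
    have sz: "s \<le> ?z k"
      unfolding s_def using Vk0 Vn a by (intro divide_left_mono) (auto simp: less_imp_le v0)
    have "?z k \<le> 1"
      using Vk Vk0 by (auto simp: real_le_rsqrt)
    then have s1: "s \<le> 1" using sz by linarith
    have bs: "\<bar>b k\<bar> = \<tau> * s"
      using v0 a[of "Suc k"] by (simp add: b_def \<tau>_def s_def v_def abs_mult)
    have "(b k)\<^sup>2 * ?r k / 2 + 4 / 3 * \<bar>b k\<bar> ^ 3 + b k ^ 4 / 8
        = (\<tau> * s)\<^sup>2 * ?r k / 2 + 4 / 3 * (\<tau> * s) ^ 3 + (\<tau> * s) ^ 4 / 8"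
      unfolding bs[symmetric] by simp
    also have "\<dots> = s\<^sup>2 * (\<tau>\<^sup>2 * (?r k / 2) + \<tau> ^ 3 * (4 / 3 * s) + \<tau> ^ 4 * (s * s / 8))"
      by (simp add: power2_eq_square power3_eq_cube power4_eq_xxxx algebra_simps)
    also have "\<dots> \<le> s\<^sup>2 * (\<tau>\<^sup>2 * (?r k + ?z k) + \<tau> ^ 3 * (2 * (?r k + ?z k)) + \<tau> ^ 4 * (?r k + ?z k))"
    proof (intro mult_left_mono add_mono)
      have ss: "s * s \<le> s" using s0 s1 by (intro mult_left_le) auto
      have r: "?r k \<ge> 0" by (rule mean_square_speed_nonneg)
      show "?r k / 2 \<le> ?r k + ?z k" using r s0 sz by linarith
      have "4 / 3 * s \<le> 2 * s" using s0 by simp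
      also have "\<dots> \<le> 2 * (?r k + ?z k)" using r sz by (intro mult_left_mono) auto
      finally show "4 / 3 * s \<le> 2 * (?r k + ?z k)" .
      show "s * s / 8 \<le> ?r k + ?z k" using ss r s0 sz by linarith
    qed (use \<tau>0 in auto)
    also have "\<dots> = (\<tau>\<^sup>2 + 2 * \<tau> ^ 3 + \<tau> ^ 4) * (s\<^sup>2 * (?r k + ?z k))"
      by (simp add: algebra_simps add_divide_distrib)
    also have "s\<^sup>2 = (?a (Suc k))\<^sup>2 / ?V n"
      using v0 by (simp add: s_def power_divide v_def)
    finally show ?thesis by simp
  qed
  then have "(\<Sum>k=1..<n. (b k)\<^sup>2 * ?r k / 2 + 4 / 3 * \<bar>b k\<bar> ^ 3 + b k ^ 4 / 8)
      \<le> (\<Sum>k=1..<n. (\<tau>\<^sup>2 + 2 * \<tau> ^ 3 + \<tau> ^ 4) * ((?a (Suc k))\<^sup>2 * (?r k + ?z k) / ?V n))"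
    by (rule sum_mono)
  also have "\<dots> = (\<tau>\<^sup>2 + 2 * \<tau> ^ 3 + \<tau> ^ 4) * relative_error n"
    unfolding relative_error_def by (simp only: sum_distrib_left sum_divide_distrib)
  finally show ?thesis .
qed

text \<open>The frequency may vary with \<open>n\<close>, so that no separate argument is required for replacing the
  natural normalisation \<open>sqrt (variance_clock \<alpha> n)\<close> by an asymptotically equivalent one.\<close>

lemma normed_char_limit:
  assumes "0 < p" "p \<le> 3/4"
    and u: "(\<lambda>n. (u n)\<^sup>2 * variance_clock (2 * p - 1) n) \<longlonglongrightarrow> s"
  shows "(\<lambda>n. \<integral>\<omega>. iexp (u n * norming (2 * p - 1) n * (walk X n \<omega> - (\<integral>\<omega>'. walk X n \<omega>' \<partial>M))) \<partial>M)
      \<longlonglongrightarrow> of_real (exp (- (s / 2)))"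
proof -
  let ?V = "variance_clock (2 * p - 1)" and ?c = "\<integral>\<omega>. X 1 \<omega> \<partial>M"
  let ?\<psi> = "\<lambda>n. \<integral>\<omega>. iexp (u n * norming (2 * p - 1) n * (walk X n \<omega> - (\<integral>\<omega>'. walk X n \<omega>' \<partial>M))) \<partial>M"
  let ?g = "\<lambda>n. of_real (exp (- ((u n)\<^sup>2 * ?V n / 2))) :: complex"
  define \<tau> where "\<tau> n = \<bar>u n\<bar> * sqrt (?V n)" for n
  have \<tau>: "\<tau> \<longlonglongrightarrow> sqrt s"
  proof -
    have "(\<lambda>n. sqrt ((u n)\<^sup>2 * ?V n)) \<longlonglongrightarrow> sqrt s"
      by (intro tendsto_real_sqrt u)
    then show ?thesis by (simp add: \<tau>_def[abs_def] real_sqrt_mult)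
  qed
  have u0: "(\<lambda>n. \<bar>u n\<bar>) \<longlonglongrightarrow> 0"
  proof -
    have top: "filterlim ?V at_top sequentially"
      by (rule variance_clock_at_top) (use assms in auto)
    have "(\<lambda>n. \<tau> n / sqrt (?V n)) \<longlonglongrightarrow> 0"
      by (intro real_tendsto_divide_at_top[OF \<tau>] filterlim_compose[OF sqrt_at_top top])
    moreover have "eventually (\<lambda>n. ?V n > 0) sequentially"
      using top unfolding filterlim_at_top_dense by blast
    then have "eventually (\<lambda>n. \<tau> n / sqrt (?V n) = \<bar>u n\<bar>) sequentially"
      by eventually_elim (simp add: \<tau>_def)
    ultimately show ?thesis by (simp add: tendsto_cong)
  qed
  have bound: "cmod (?\<psi> n - ?g n) \<le> 2 * \<bar>u n\<bar> + ((\<tau> n)\<^sup>2 + 2 * \<tau> n ^ 3 + \<tau> n ^ 4) * relative_error n"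
    if n: "n \<ge> 1" for n
  proof -
    have "?\<psi> n = (\<integral>\<omega>. iexp (- (u n * ?c)) * iexp (u n * norming (2 * p - 1) n * walk X n \<omega>) \<partial>M)"
    proof (intro Bochner_Integration.integral_cong refl)
      fix \<omega>
      have e: "u n * norming (2 * p - 1) n * (walk X n \<omega> - (\<integral>\<omega>'. walk X n \<omega>' \<partial>M))
          = - (u n * ?c) + u n * norming (2 * p - 1) n * walk X n \<omega>"
        unfolding normed_mean_constant[OF assms(1) n, symmetric] by (simp add: algebra_simps)
      show "iexp (u n * norming (2 * p - 1) n * (walk X n \<omega> - (\<integral>\<omega>'. walk X n \<omega>' \<partial>M)))
          = iexp (- (u n * ?c)) * iexp (u n * norming (2 * p - 1) n * walk X n \<omega>)"
        unfolding e by (simp only: of_real_add distrib_left exp_add)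
    qed
    also have "\<dots> = iexp (- (u n * ?c)) * normed_char n (u n)"
      unfolding normed_char_def by (rule integral_mult_right_zero)
    finally have "?\<psi> n - ?g n = iexp (- (u n * ?c)) * (normed_char n (u n) - ?g n * iexp (u n * ?c))"
      by (simp add: right_diff_distrib mult.left_commute[of _ "?g n"] flip: exp_add)
    then have "cmod (?\<psi> n - ?g n) = cmod (normed_char n (u n) - ?g n * iexp (u n * ?c))"
      by (simp only: norm_mult norm_exp_i_times mult_1)
    also have "\<dots> \<le> 2 * \<bar>u n\<bar> + ((\<tau> n)\<^sup>2 + 2 * \<tau> n ^ 3 + \<tau> n ^ 4) * relative_error n"
      using normed_char_error[OF assms(1,2) n, of "u n"] summed_error_bound[OF assms(1), of "u n" n]
      unfolding \<tau>_def by linarith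
    finally show ?thesis .
  qed
  have "(\<lambda>n. 2 * \<bar>u n\<bar> + ((\<tau> n)\<^sup>2 + 2 * \<tau> n ^ 3 + \<tau> n ^ 4) * relative_error n)
      \<longlonglongrightarrow> 2 * 0 + ((sqrt s)\<^sup>2 + 2 * sqrt s ^ 3 + sqrt s ^ 4) * 0"
    by (intro tendsto_intros u0 \<tau> relative_error_tendsto_0 assms)
  then have bound0: "(\<lambda>n. 2 * \<bar>u n\<bar> + ((\<tau> n)\<^sup>2 + 2 * \<tau> n ^ 3 + \<tau> n ^ 4) * relative_error n) \<longlonglongrightarrow> 0"
    by simp
  have "(\<lambda>n. ?\<psi> n - ?g n) \<longlonglongrightarrow> 0"
    by (rule Lim_null_comparison[OF eventually_mono[OF eventually_ge_at_top[of 1] bound] bound0])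
  moreover have "?g \<longlonglongrightarrow> of_real (exp (- (s / 2)))"
    by (intro tendsto_intros u) auto
  ultimately have "(\<lambda>n. (?\<psi> n - ?g n) + ?g n) \<longlonglongrightarrow> 0 + of_real (exp (- (s / 2)))"
    by (rule tendsto_add)
  then show ?thesis by simp
qed

text \<open>Both regimes at once. The hypothesis on \<open>D\<close> makes \<open>(norming \<alpha> n)\<^sup>2 * D n\<close> asymptotic to \<open>L\<close>
  times the variance clock, so at the frequency \<open>u n = t / (norming \<alpha> n * sqrt (D n))\<close> the
  accumulated variance tends to \<open>t\<^sup>2 / L\<close>.\<close>

lemma centred_walk_clt:
  fixes D :: "nat \<Rightarrow> real"
  assumes "0 < p" "p \<le> 3/4" "L > 0"
    and incr: "(\<lambda>n. D (Suc n) - D n * (1 + (2 * p - 1) / real n)\<^sup>2) \<longlonglongrightarrow> L"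
  shows "converges_in_distribution M
      (\<lambda>n \<omega>. (walk X n \<omega> - (\<integral>\<omega>'. walk X n \<omega>' \<partial>M)) / sqrt (D n)) (gaussian 0 (1 / L))"
  unfolding converges_in_distribution_def
proof (rule levy_continuity)
  let ?V = "variance_clock (2 * p - 1)" and ?a = "norming (2 * p - 1)"
  let ?Y = "\<lambda>n \<omega>. (walk X n \<omega> - (\<integral>\<omega>'. walk X n \<omega>' \<partial>M)) / sqrt (D n)"
  have [measurable]: "?Y n \<in> borel_measurable M" for n by measurable
  show "real_distribution (distr M borel (?Y n))" for n
    by (rule real_distribution_distr) measurable
  show "real_distribution (gaussian 0 (1 / L))"
    using assms(3) by (intro real_distribution_gaussian) simp
  have a: "?a n > 0" for n using assms(1) by (intro norming_pos) auto
  fix t :: real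
  define u where "u n = t / (?a n * sqrt (D n))" for n
  have ratio: "(\<lambda>n. (?a n)\<^sup>2 * D n / ?V n) \<longlonglongrightarrow> L"
    using assms by (intro scaled_norming_limit) auto
  \<comment> \<open>Positivity of \<open>D\<close> follows from the limit of the ratio, as \<open>L > 0\<close>.\<close>
  have D: "eventually (\<lambda>n. D n > 0) sequentially"
    using order_tendstoD(1)[OF ratio assms(3)]
  proof eventually_elim
    case (elim n)
    then show ?case using a[of n] variance_clock_nonneg[of "2 * p - 1" n]
      by (auto simp: zero_less_divide_iff zero_less_mult_iff)
  qed
  have "(\<lambda>n. t\<^sup>2 / ((?a n)\<^sup>2 * D n / ?V n)) \<longlonglongrightarrow> t\<^sup>2 / L"
    using assms(3) by (intro tendsto_intros ratio) auto
  moreover have "eventually (\<lambda>n. t\<^sup>2 / ((?a n)\<^sup>2 * D n / ?V n) = (u n)\<^sup>2 * ?V n) sequentially"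
    using D by eventually_elim (simp add: u_def power_divide power_mult_distrib)
  ultimately have "(\<lambda>n. (u n)\<^sup>2 * ?V n) \<longlonglongrightarrow> t\<^sup>2 / L"
    by (simp add: tendsto_cong)
  from normed_char_limit[OF assms(1,2) this]
  have "(\<lambda>n. \<integral>\<omega>. iexp (u n * ?a n * (walk X n \<omega> - (\<integral>\<omega>'. walk X n \<omega>' \<partial>M))) \<partial>M)
      \<longlonglongrightarrow> of_real (exp (- (t\<^sup>2 / L / 2)))" .
  moreover have "(\<integral>\<omega>. iexp (u n * ?a n * (walk X n \<omega> - (\<integral>\<omega>'. walk X n \<omega>' \<partial>M))) \<partial>M)
      = char (distr M borel (?Y n)) t" for n
  proof -
    have "u n * ?a n * (walk X n \<omega> - (\<integral>\<omega>'. walk X n \<omega>' \<partial>M)) = t * ?Y n \<omega>" for \<omega>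
      using a[of n] by (simp add: u_def)
    then show ?thesis
      unfolding char_def by (subst integral_distr) auto
  qed
  ultimately show "(\<lambda>n. char (distr M borel (?Y n)) t) \<longlonglongrightarrow> char (gaussian 0 (1 / L)) t"
    using assms(3) by (simp add: char_gaussian)
qed

end

theorem theorem2p5:
  fixes M :: "'a measure"
    and q p \<alpha> :: real
    and X :: "nat \<Rightarrow> 'a \<Rightarrow> real"
    and U :: "nat \<Rightarrow> 'a \<Rightarrow> nat"
    and K :: "nat \<Rightarrow> 'a \<Rightarrow> bool"
  assumes "0 < q" and "q \<le> 1"
    and "0 < p" and "p < 1"
    and "elephant_random_walk M q p X U K"
    and "\<alpha> = 2 * p - 1"
  shows "(\<alpha> < 1/2 \<longrightarrow>
            converges_in_distribution M
              (\<lambda>n \<omega>. (walk X n \<omega> - (\<integral>\<omega>'. walk X n \<omega>' \<partial>M)) / sqrt (real n))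
              (gaussian 0 (1 / (1 - 2 * \<alpha>)))) \<and>
         (\<alpha> = 1/2 \<longrightarrow>
            converges_in_distribution M
              (\<lambda>n \<omega>. (walk X n \<omega> - (\<integral>\<omega>'. walk X n \<omega>' \<partial>M)) / sqrt (real n * ln (real n)))
              (gaussian 0 1))"
proof (intro conjI impI)
  interpret elephant_random_walk M q p X U K by fact
  show "converges_in_distribution M
      (\<lambda>n \<omega>. (walk X n \<omega> - (\<integral>\<omega>'. walk X n \<omega>' \<partial>M)) / sqrt (real n))
      (gaussian 0 (1 / (1 - 2 * \<alpha>)))" if "\<alpha> < 1/2"
    using that assms norming_increment_linear[of \<alpha>] by (intro centred_walk_clt) auto
  show "converges_in_distribution M
      (\<lambda>n \<omega>. (walk X n \<omega> - (\<integral>\<omega>'. walk X n \<omega>' \<partial>M)) / sqrt (real n * ln (real n)))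
      (gaussian 0 1)" if "\<alpha> = 1/2"
  proof -
    have \<alpha>: "2 * p - 1 = 1/2" using that assms by simp
    have "converges_in_distribution M
        (\<lambda>n \<omega>. (walk X n \<omega> - (\<integral>\<omega>'. walk X n \<omega>' \<partial>M)) / sqrt (real n * ln (real n)))
        (gaussian 0 (1 / 1))"
    proof (rule centred_walk_clt)
      show "(\<lambda>n. real (Suc n) * ln (real (Suc n)) - real n * ln (real n) * (1 + (2 * p - 1) / real n)\<^sup>2)
          \<longlonglongrightarrow> 1"
        unfolding \<alpha> by (rule norming_increment_critical)
    qed (use \<alpha> in auto)
    then show ?thesis by simp
  qed
qed

end
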